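(* Consider the criterion $$\mathcal{R}(g_1,g_2)=\sum_{i=1}^n\Bigl(H(g_2(z_i))+h(g_2(z_i))\bigl(L(g_1(z_i),y_i)-g_2(z_i)\bigr)\Bigr).$$ (a) Let $g_1:\{z_1,\dots,z_n\}\to\mathbb{R}$ be given. Then the optimal antitonic solution $\hat g_2$ for $g_1$ fixed (that is, the minimizer of $\mathcal{R}(g_1,\cdot)$ among all decreasing functions $g_2:\{z_1,\dots,z_n\}\to\mathbb{R}$) is given by $$\hat g_2(z_\ell)=-\min_{j\ge\ell}\max_{i\le j}-\mathbb{E}(\bar P_{i:j})=-\max_{i\le\ell}\min_{j\ge i}-\mathbb{E}(\bar P_{i:j}),\qquad \ell=1,\dots,n,$$ where $\bar P_{i:j}$ is the empirical distribution of $L(g_1(z_i),y_i),\dots,L(g_1(z_j),y_j)$. (b) Let $g_2:\{z_1,\dots,z_n\}\to\mathbb{R}$ be given. Then any optimal isotonic solution $\hat g_1$ for $g_2$ fixed (that is, any minimizer of $\mathcal{R}(\cdot,g_2)$ among all increasing functions $g_1:\{z_1,\dots,z_n\}\to\mathbb{R}$) satisfies $$\min_{j\ge\ell}\max_{i\le j}T^-(P^w_{i:j})\le\hat g_1(z_\ell)\le\max_{i\le\ell}\min_{j\ge i}T^+(P^w_{i:j}),\qquad \ell=1,\dots,n,$$ where $P^w_{i:j}$ is the weighted empirical distribution of $y_i,\dots,y_j$ with weights proportional to $h(g_2(z_i)),\dots,h(g_2(z_j))$.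
   Context: A function $V:\mathbb{R}\times\mathbb{R}\to\mathbb{R}$ is an identification function if $V(\cdot,y)$ is increasing and left-continuous for every $y\in\mathbb{R}$. Fix such a $V$. For a probability measure $P$ on $\mathbb{R}$ with finite support write $V(x_1,P)=\int V(x_1,y)\,\mathrm{d}P(y)$. The functional $T$ induced by $V$ is $T(P)=[T^-(P),T^+(P)]\subseteq[-\infty,\infty]$ with $T^-(P)=\sup\{x_1:V(x_1,P)<0\}$ and $T^+(P)=\inf\{x_1:V(x_1,P)>0\}$. $\mathcal{L}$ is the class of loss functions $(x_1,y)\mapsto\int_{\mathbb{R}}(\mathbf{1}\{\eta\le x_1\}-\mathbf{1}\{\eta\le y\})V(\eta,y)\,\mathrm{d}H_1(\eta)$ with $H_1$ a positive measure on $\mathbb{R}$. Fix $L\in\mathcal{L}$ strictly consistent for $T$: for every finitely supported $P$, every $t\in T(P)$ and every $x\in\mathbb{R}$, $\int L(t,y)\,\mathrm{d}P(y)\le\int L(x,y)\,\mathrm{d}P(y)$, with strict inequality if $x\notin T(P)$. Observations $(z_1,y_1),\dots,(z_n,y_n)$ are given with $y_i\in\mathbb{R}$ and totally ordered covariates $z_1<\dots<z_n$. The function $h:\mathbb{R}\to(0,\infty)$ is decreasing with $\lim_{x\to\infty}h(x)=0$, and $H(r)=\int_0^r h(x)\,\mathrm{d}x$. "Increasing" (isotonic) and "decreasing" (antitonic) are meant in the non-strict sense. $\mathbb{E}(P)$ denotes the mean of $P$. Indices $i,j,\ell$ range over $\{1,\dots,n\}$.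
   Formalization: In (a), the formula is shown to give a minimizer for every decreasing h, but that it is the only minimizer is asserted only when h is strictly decreasing, since uniqueness fails if h is constant near a fitted value. *)

theory Defs
  imports "HOL-Probability.Probability"
begin

definition identification_function :: "(real \<Rightarrow> real \<Rightarrow> real) \<Rightarrow> bool" where
  "identification_function V \<longleftrightarrow>
     (\<forall>y. mono (\<lambda>x. V x y) \<and> (\<forall>x. continuous (at_left x) (\<lambda>x. V x y)))"

definition V_mean :: "(real \<Rightarrow> real \<Rightarrow> real) \<Rightarrow> real \<Rightarrow> real pmf \<Rightarrow> real" where
  "V_mean V x P = measure_pmf.expectation P (\<lambda>y. V x y)"

definition T_minus :: "(real \<Rightarrow> real \<Rightarrow> real) \<Rightarrow> real pmf \<Rightarrow> ereal" where
  "T_minus V P = Sup (ereal ` {x. V_mean V x P < 0})"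

definition T_plus :: "(real \<Rightarrow> real \<Rightarrow> real) \<Rightarrow> real pmf \<Rightarrow> ereal" where
  "T_plus V P = Inf (ereal ` {x. V_mean V x P > 0})"

definition T_functional :: "(real \<Rightarrow> real \<Rightarrow> real) \<Rightarrow> real pmf \<Rightarrow> ereal set" where
  "T_functional V P = {T_minus V P .. T_plus V P}"

text \<open>The integrability requirement says that the integral defining the loss exists and is finite
  for all arguments. It holds automatically when \<open>H1\<close> is locally finite.\<close>

definition loss_class :: "(real \<Rightarrow> real \<Rightarrow> real) \<Rightarrow> (real \<Rightarrow> real \<Rightarrow> real) set" where
  "loss_class V = {L. \<exists>H1 :: real measure. sets H1 = sets borel \<and>
     (\<forall>x y.
        integrable H1 (\<lambda>\<eta>. (indicator {..x} \<eta> - indicator {..y} \<eta>) * V \<eta> y) \<and>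
        L x y = (LINT \<eta>|H1. (indicator {..x} \<eta> - indicator {..y} \<eta>) * V \<eta> y))}"

text \<open>The set \<open>T_functional V P\<close> may contain \<open>\<plusminus>\<infinity>\<close>, where a real loss function is not defined.
  The expected loss there is the limit of the expected loss at real arguments. If \<open>\<infinity>\<close> (or
  \<open>-\<infinity>\<close>) belongs to \<open>T_functional V P\<close> and \<open>L \<in> loss_class V\<close>, then the expected loss is
  antitone (isotone) in its argument, so that this limit exists in the extended reals.\<close>

definition expected_loss :: "(real \<Rightarrow> real \<Rightarrow> real) \<Rightarrow> real pmf \<Rightarrow> ereal \<Rightarrow> ereal" where
  "expected_loss L P t =
     (case t of
        ereal x \<Rightarrow> ereal (measure_pmf.expectation P (\<lambda>y. L x y))
      | PInfty \<Rightarrow> Lim at_top (\<lambda>x. ereal (measure_pmf.expectation P (\<lambda>y. L x y)))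
      | MInfty \<Rightarrow> Lim at_bot (\<lambda>x. ereal (measure_pmf.expectation P (\<lambda>y. L x y))))"

definition strictly_consistent ::
  "(real \<Rightarrow> real \<Rightarrow> real) \<Rightarrow> (real pmf \<Rightarrow> ereal set) \<Rightarrow> bool" where
  "strictly_consistent L T \<longleftrightarrow>
     (\<forall>P. finite (set_pmf P) \<longrightarrow>
       (\<forall>t\<in>T P. \<forall>x::real.
          expected_loss L P t \<le> expected_loss L P (ereal x) \<and>
          (ereal x \<notin> T P \<longrightarrow> expected_loss L P t < expected_loss L P (ereal x))))"

definition int_h :: "(real \<Rightarrow> real) \<Rightarrow> real \<Rightarrow> real" where
  "int_h h r = (LBINT x=ereal 0..ereal r. h x)"

definition criterion ::
  "nat \<Rightarrow> (nat \<Rightarrow> 'z) \<Rightarrow> (nat \<Rightarrow> real) \<Rightarrow> (real \<Rightarrow> real) \<Rightarrow> (real \<Rightarrow> real \<Rightarrow> real) \<Rightarrow>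
   ('z \<Rightarrow> real) \<Rightarrow> ('z \<Rightarrow> real) \<Rightarrow> real" where
  "criterion n z y h L g1 g2 =
     (\<Sum>i=1..n. int_h h (g2 (z i)) + h (g2 (z i)) * (L (g1 (z i)) (y i) - g2 (z i)))"

text \<open>Functions on \<open>{z 1, \<dots>, z n}\<close> are represented by functions on the whole covariate type.
  Only their values on \<open>z ` {1..n}\<close> matter below.\<close>

definition optimal_antitonic ::
  "nat \<Rightarrow> (nat \<Rightarrow> 'z::linorder) \<Rightarrow> (nat \<Rightarrow> real) \<Rightarrow> (real \<Rightarrow> real) \<Rightarrow>
   (real \<Rightarrow> real \<Rightarrow> real) \<Rightarrow> ('z \<Rightarrow> real) \<Rightarrow> ('z \<Rightarrow> real) \<Rightarrow> bool" where
  "optimal_antitonic n z y h L g1 g2 \<longleftrightarrow>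
     antimono_on (z ` {1..n}) g2 \<and>
     (\<forall>g. antimono_on (z ` {1..n}) g \<longrightarrow> criterion n z y h L g1 g2 \<le> criterion n z y h L g1 g)"

definition optimal_isotonic ::
  "nat \<Rightarrow> (nat \<Rightarrow> 'z::linorder) \<Rightarrow> (nat \<Rightarrow> real) \<Rightarrow> (real \<Rightarrow> real) \<Rightarrow>
   (real \<Rightarrow> real \<Rightarrow> real) \<Rightarrow> ('z \<Rightarrow> real) \<Rightarrow> ('z \<Rightarrow> real) \<Rightarrow> bool" where
  "optimal_isotonic n z y h L g2 g1 \<longleftrightarrow>
     mono_on (z ` {1..n}) g1 \<and>
     (\<forall>g. mono_on (z ` {1..n}) g \<longrightarrow> criterion n z y h L g1 g2 \<le> criterion n z y h L g g2)"

definition pmf_mean :: "real pmf \<Rightarrow> real" where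
  "pmf_mean P = measure_pmf.expectation P (\<lambda>x. x)"

definition empirical :: "(nat \<Rightarrow> real) \<Rightarrow> nat \<Rightarrow> nat \<Rightarrow> real pmf" where
  "empirical v i j = map_pmf v (pmf_of_set {i..j})"

text \<open>For \<open>i \<le> j\<close> and positive weights, the argument of \<open>embed_pmf\<close> is a probability mass
  function on the indices.\<close>

definition weighted_empirical ::
  "(nat \<Rightarrow> real) \<Rightarrow> (nat \<Rightarrow> real) \<Rightarrow> nat \<Rightarrow> nat \<Rightarrow> real pmf" where
  "weighted_empirical w v i j =
     map_pmf v (embed_pmf (\<lambda>s. if s \<in> {i..j} then w s / (\<Sum>k=i..j. w k) else 0))"

lemma expectation_weighted_empirical:
  fixes f :: "real \<Rightarrow> real"
  assumes "i \<le> j" and w: "\<And>s. s \<in> {i..j} \<Longrightarrow> w s > 0"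
  shows "measure_pmf.expectation (weighted_empirical w v i j) f =
    (\<Sum>s=i..j. w s * f (v s)) / (\<Sum>s=i..j. w s)"
proof -
  let ?W = "\<Sum>k=i..j. w k"
  let ?q = "\<lambda>s. if s \<in> {i..j} then w s / ?W else 0"
  have W: "?W > 0" using assms by (intro sum_pos) auto
  have nonneg: "0 \<le> ?q s" for s
    using w[of s] W by (cases "s \<in> {i..j}") (simp_all add: divide_nonneg_pos less_imp_le)
  have "(\<integral>\<^sup>+s. ennreal (?q s) \<partial>count_space UNIV) = (\<Sum>s\<in>{i..j}. ennreal (?q s))"
    by (rule nn_integral_count_space') auto
  also have "\<dots> = ennreal (\<Sum>s\<in>{i..j}. ?q s)" by (rule sum_ennreal) (rule nonneg)
  also have "(\<Sum>s\<in>{i..j}. ?q s) = 1" using W by (simp flip: sum_divide_distrib)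
  finally have one: "(\<integral>\<^sup>+s. ennreal (?q s) \<partial>count_space UNIV) = 1" by simp
  have p: "pmf (embed_pmf ?q) s = ?q s" for s by (rule pmf_embed_pmf[OF nonneg one])
  have "measure_pmf.expectation (weighted_empirical w v i j) f =
      (\<Sum>s\<in>{i..j}. ?q s * f (v s))"
    unfolding weighted_empirical_def integral_map_pmf
    by (subst integral_measure_pmf[where A = "{i..j}"])
      (auto simp: set_embed_pmf[OF nonneg one] p simp del: atLeastAtMost_iff split: if_splits)
  also have "\<dots> = (\<Sum>s=i..j. w s * f (v s)) / ?W"
    by (simp add: sum_divide_distrib)
  finally show ?thesis .
qed

end

theory Submission
  imports Defs
begin

text \<open>
  Part (a). Write \<open>a s\<close> for the loss of \<open>g1\<close> at observation \<open>s\<close>. Since \<open>int_h h\<close> is concave with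
  supergradient \<open>h\<close>, the term \<open>int_h h r + h r * (a - r)\<close> is a consistent score for the mean. For such
  scores the monotone least squares fit is optimal, whatever \<open>h\<close> is.
  The fit \<open>x\<close> of \<open>- a\<close> is described by its optimality conditions
  (\<open>isotonic_fit\<close>): its partial sums lie below those of \<open>- a\<close> and touch them at the ends of the level
  sets. A fit exists by splitting off the initial segment of minimal mean (\<open>isotonic_fit_exists\<close>).
  The ends of the level set of an index are a saddle point for the means over \<open>{i..j}\<close>, so both the
  min-max and the max-min formula give the fit (\<open>isotonic_fit_saddle_point\<close>). Summation by parts
  against the monotone function \<open>h \<circ> g2\<close> shows that \<open>- x\<close> is optimal, and that it is the only optimum
  when \<open>h\<close> is strictly decreasing (\<open>criterion_gap\<close>).

  Part (b). With \<open>g2\<close> fixed, the weights \<open>h (g2 (z s))\<close> are positive constants, and a weighted sum of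
  losses must be minimized over isotonic sequences. If the lower bound fails at \<open>l\<close>, then for every
  \<open>j \<ge> l\<close> some block \<open>{i0..j}\<close> has its lower functional value above \<open>g1 (z l)\<close>. For a good choice
  of \<open>j\<close> and of \<open>i \<le> j\<close>, raising \<open>g1\<close> to a common value on \<open>{i..j}\<close> keeps it isotonic and strictly reduces
  the sum, contradicting optimality (\<open>isotonic_optimum_lower_bound\<close>). The upper bound is the mirror
  image, where the right limit of \<open>V\<close> replaces its value because a difference of losses at \<open>a < b\<close>
  integrates \<open>V\<close> over \<open>{a<..b}\<close>, without the left endpoint.

  The generating measure of the loss may vanish on whole intervals, so losses can be constant between
  different values. Strict gains come from strict consistency, which makes the functional value of a
  block strictly better than any real number outside the functional
  (\<open>improvement_below_T_minus\<close>, \<open>improvement_above_T_plus\<close>), also when this value is infinite.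
\<close>

section \<open>Saddle indices and min-max formulas\<close>

text \<open>The four bounds below turn a saddle index into a bound on a min-max or max-min formula: one \<open>j\<close> that
  is good against all \<open>i\<close> bounds both formulas from above, one \<open>i\<close> that is good against all \<open>j\<close>
  bounds both from below. With both indices present the two formulas coincide.\<close>

lemma minimax_le:
  fixes M :: "nat \<Rightarrow> nat \<Rightarrow> 'a::linorder"
  assumes "l \<in> {1..n}" "j \<in> {l..n}" "\<And>i. i \<in> {1..j} \<Longrightarrow> M i j \<le> v"
  shows "(MIN j\<in>{l..n}. MAX i\<in>{1..j}. M i j) \<le> v"
proof -
  have "(MIN j\<in>{l..n}. MAX i\<in>{1..j}. M i j) \<le> (MAX i\<in>{1..j}. M i j)"
    using assms by (intro Min_le) auto
  also have "\<dots> \<le> v" using assms by (intro Max.boundedI) auto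
  finally show ?thesis .
qed

lemma le_minimax:
  fixes M :: "nat \<Rightarrow> nat \<Rightarrow> 'a::linorder"
  assumes "l \<in> {1..n}" "i \<in> {1..l}" "\<And>j. j \<in> {i..n} \<Longrightarrow> v \<le> M i j"
  shows "v \<le> (MIN j\<in>{l..n}. MAX i\<in>{1..j}. M i j)"
proof -
  have "v \<le> (MAX i\<in>{1..j}. M i j)" if "j \<in> {l..n}" for j
  proof -
    have "v \<le> M i j" using assms that by auto
    also have "\<dots> \<le> (MAX i\<in>{1..j}. M i j)" using assms that by (intro Max_ge) auto
    finally show ?thesis .
  qed
  then show ?thesis using assms by (intro Min.boundedI) auto
qed

lemma le_maximin:
  fixes M :: "nat \<Rightarrow> nat \<Rightarrow> 'a::linorder"
  assumes "l \<in> {1..n}" "i \<in> {1..l}" "\<And>j. j \<in> {i..n} \<Longrightarrow> v \<le> M i j"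
  shows "v \<le> (MAX i\<in>{1..l}. MIN j\<in>{i..n}. M i j)"
proof -
  have "v \<le> (MIN j\<in>{i..n}. M i j)" using assms by (intro Min.boundedI) auto
  also have "\<dots> \<le> (MAX i\<in>{1..l}. MIN j\<in>{i..n}. M i j)"
    using assms by (intro Max_ge) auto
  finally show ?thesis .
qed

lemma maximin_le:
  fixes M :: "nat \<Rightarrow> nat \<Rightarrow> 'a::linorder"
  assumes "l \<in> {1..n}" "j \<in> {l..n}" "\<And>i. i \<in> {1..j} \<Longrightarrow> M i j \<le> v"
  shows "(MAX i\<in>{1..l}. MIN j\<in>{i..n}. M i j) \<le> v"
proof -
  have "(MIN j\<in>{i..n}. M i j) \<le> v" if "i \<in> {1..l}" for i
  proof -
    have "(MIN j\<in>{i..n}. M i j) \<le> M i j" using assms that by (intro Min_le) auto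
    also have "\<dots> \<le> v" using assms that by auto
    finally show ?thesis .
  qed
  then show ?thesis using assms by (intro Max.boundedI) auto
qed

section \<open>Isotonic least squares regression\<close>

text \<open>These are the optimality conditions of isotonic regression of \<open>b\<close> under squared error. They say
  that the partial sums of \<open>x\<close> form the greatest convex minorant of the partial sums of \<open>b\<close>: they
  are convex, lie below, and touch at \<open>n\<close> and wherever the slope changes. The left end \<open>p\<close> is
  variable because the existence proof peels off blocks from the left.\<close>

definition isotonic_fit :: "nat \<Rightarrow> nat \<Rightarrow> (nat \<Rightarrow> real) \<Rightarrow> (nat \<Rightarrow> real) \<Rightarrow> bool" where
  "isotonic_fit p n b x \<longleftrightarrow>
     mono_on {p..n} x \<and>
     (\<forall>k\<in>{p..n}. sum x {p..k} \<le> sum b {p..k}) \<and>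
     (\<forall>k\<in>{p..n}. k = n \<or> x k < x (Suc k) \<longrightarrow> sum x {p..k} = sum b {p..k})"

lemma block_end_exists:
  fixes x :: "nat \<Rightarrow> real"
  assumes "mono_on {p..n} x" "l \<in> {p..n}"
  obtains j where "j \<in> {l..n}" "x j = x l" "j = n \<or> x j < x (Suc j)"
proof -
  let ?J = "{j \<in> {l..n}. x j = x l}"
  define j where "j = Max ?J"
  have "j \<in> ?J" unfolding j_def using assms by (intro Max_in) auto
  moreover have "x j < x (Suc j)" if "j \<noteq> n"
  proof -
    have "Suc j \<notin> ?J"
    proof
      assume "Suc j \<in> ?J"
      then have "Suc j \<le> j" using Max_ge[of ?J "Suc j"] unfolding j_def by auto
      then show False by simp
    qed
    moreover have "x j \<le> x (Suc j)"
      using \<open>j \<in> ?J\<close> that assms by (intro mono_onD[OF assms(1)]) auto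
    ultimately show ?thesis using \<open>j \<in> ?J\<close> that by auto
  qed
  ultimately show ?thesis using that by blast
qed

lemma block_start_exists:
  fixes x :: "nat \<Rightarrow> real"
  assumes "mono_on {p..n} x" "l \<in> {p..n}"
  obtains i where "i \<in> {p..l}" "x i = x l" "i = p \<or> x (i - 1) < x i"
proof -
  let ?I = "{i \<in> {p..l}. x i = x l}"
  define i where "i = Min ?I"
  have i: "i \<in> ?I" unfolding i_def using assms by (intro Min_in) auto
  moreover have "x (i - 1) < x i" if "i \<noteq> p"
  proof -
    have "i - 1 \<notin> ?I"
    proof
      assume "i - 1 \<in> ?I"
      then have "i \<le> i - 1" using Min_le[of ?I "i - 1"] unfolding i_def by auto
      then show False using i that by auto
    qed
    moreover have "x (i - 1) \<le> x i"
      using i that assms by (intro mono_onD[OF assms(1)]) auto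
    ultimately show ?thesis using i that by auto
  qed
  ultimately show ?thesis using that by blast
qed

text \<open>The first block \<open>{p..m}\<close> is chosen to minimize the mean of \<open>b\<close> over initial segments, which places
  its partial sums below those of \<open>b\<close>. A fit of the remaining sequence supplies the later blocks.\<close>

lemma isotonic_fit_exists:
  "\<exists>x. isotonic_fit p n b x"
proof (induction "Suc n - p" arbitrary: p rule: less_induct)
  case less
  show ?case
  proof (cases "p \<le> n")
    case False
    then show ?thesis by (auto simp: isotonic_fit_def mono_on_def)
  next
    case True
    define avg where "avg k = sum b {p..k} / real (Suc k - p)" for k
    obtain m where m: "m \<in> {p..n}" and m_min: "\<And>k. k \<in> {p..n} \<Longrightarrow> avg m \<le> avg k"
      using ex_min_if_finite[of "avg ` {p..n}"] True
      by (auto simp: not_less)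
    define \<mu> where "\<mu> = avg m"
    have low: "real (Suc k - p) * \<mu> \<le> sum b {p..k}" if "k \<in> {p..n}" for k
      using m_min[OF that] that by (simp add: avg_def[of k] \<mu>_def field_simps)
    have eq: "real (Suc m - p) * \<mu> = sum b {p..m}"
      using m by (simp add: avg_def \<mu>_def)
    obtain x where x: "isotonic_fit (Suc m) n b x"
      using less[of "Suc m"] m by fastforce
    note x_mono = x[unfolded isotonic_fit_def, THEN conjunct1]
    have split: "sum f {p..k} = sum f {p..m} + sum f {Suc m..k}" if "k \<in> {m..n}"
      for f :: "nat \<Rightarrow> real" and k
      using sum.ub_add_nat[of p m f "k - m"] m that by auto
    \<comment> \<open>The block after the first has a mean of at least \<open>\<mu>\<close>, or appending it to
      the first block would give a smaller mean.\<close>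
    have jump: "\<mu> \<le> x (Suc m)" if m_less: "m < n"
    proof -
      obtain j where j: "j \<in> {Suc m..n}" "x j = x (Suc m)" "j = n \<or> x j < x (Suc j)"
        using block_end_exists[OF x_mono, of "Suc m"] m_less by auto
      have "x s = x (Suc m)" if s: "s \<in> {Suc m..j}" for s
      proof (rule antisym)
        show "x s \<le> x (Suc m)"
          unfolding j(2)[symmetric] by (rule mono_onD[OF x_mono]) (use s j in auto)
        show "x (Suc m) \<le> x s" by (rule mono_onD[OF x_mono]) (use s j in auto)
      qed
      then have "sum x {Suc m..j} = (\<Sum>s\<in>{Suc m..j}. x (Suc m))" by (rule sum.cong[OF refl])
      then have "real (j - m) * x (Suc m) = sum x {Suc m..j}" by simp
      also have "\<dots> = sum b {Suc m..j}" using x j by (auto simp: isotonic_fit_def)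
      also have "\<dots> \<ge> real (Suc j - p) * \<mu> - real (Suc m - p) * \<mu>"
        using low[of j] split[of j b] eq j m by auto
      also have "real (Suc j - p) * \<mu> - real (Suc m - p) * \<mu> = real (j - m) * \<mu>"
        using j m by (auto simp: of_nat_diff algebra_simps)
      finally show ?thesis using j by auto
    qed
    define x' where "x' s = (if s \<le> m then \<mu> else x s)" for s
    have first: "sum x' {p..k} = real (Suc k - p) * \<mu>" if "k \<in> {p..m}" for k
    proof -
      have "sum x' {p..k} = (\<Sum>s\<in>{p..k}. \<mu>)"
        using that by (intro sum.cong) (auto simp: x'_def)
      then show ?thesis by simp
    qed
    have later: "sum x' {p..k} - sum b {p..k} = sum x {Suc m..k} - sum b {Suc m..k}"
      if "k \<in> {Suc m..n}" for k
    proof -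
      have "sum x' {Suc m..k} = sum x {Suc m..k}" by (intro sum.cong) (auto simp: x'_def)
      then show ?thesis using split[of k x'] split[of k b] first[of m] eq that m by auto
    qed
    have "isotonic_fit p n b x'"
      unfolding isotonic_fit_def
    proof (intro conjI ballI impI)
      show "mono_on {p..n} x'"
      proof (rule mono_onI)
        fix r s assume rs: "r \<in> {p..n}" "s \<in> {p..n}" "r \<le> s"
        show "x' r \<le> x' s"
        proof (cases "r \<le> m \<and> m < s")
          case True
          have "\<mu> \<le> x (Suc m)" using jump True rs by auto
          also have "\<dots> \<le> x s" using True rs by (intro mono_onD[OF x_mono]) auto
          finally show ?thesis using True by (auto simp: x'_def)
        next
          case False
          then show ?thesis using rs mono_onD[OF x_mono, of r s] by (auto simp: x'_def)
        qed
      qed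
    next
      fix k assume k: "k \<in> {p..n}"
      show "sum x' {p..k} \<le> sum b {p..k}"
      proof (cases "k \<le> m")
        case True
        then show ?thesis using first[of k] low[of k] k by auto
      next
        case False
        then have "sum x {Suc m..k} \<le> sum b {Suc m..k}"
          using x k by (auto simp: isotonic_fit_def)
        then show ?thesis using later[of k] False k by auto
      qed
    next
      fix k assume k: "k \<in> {p..n}" "k = n \<or> x' k < x' (Suc k)"
      show "sum x' {p..k} = sum b {p..k}"
      proof (cases "k \<le> m")
        case True
        then have "k = m" using k m by (auto simp: x'_def split: if_splits)
        then show ?thesis using first[of k] eq m by auto
      next
        case False
        then have "sum x {Suc m..k} = sum b {Suc m..k}"
          using x k by (auto simp: isotonic_fit_def x'_def)
        then show ?thesis using later[of k] False k by auto
      qed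
    qed
    then show ?thesis by blast
  qed
qed

text \<open>Up to the last index \<open>j\<close> of the block of \<open>l\<close> the partial sums of \<open>x\<close> and \<open>b\<close> agree, and
  before it those of \<open>x\<close> are at most those of \<open>b\<close>. Subtracting, the sum of \<open>b\<close> over \<open>{i..j}\<close> is at
  most that of \<open>x\<close>, whose terms are at most \<open>x l\<close>. The first index of the block plays the same
  part for the lower bound.\<close>

lemma isotonic_fit_saddle_point:
  assumes fit: "isotonic_fit 1 n b x" and l: "l \<in> {1..n}"
  shows "\<exists>j\<in>{l..n}. \<forall>i\<in>{1..j}. sum b {i..j} / real (Suc j - i) \<le> x l" (is ?upper)
    and "\<exists>i\<in>{1..l}. \<forall>j\<in>{i..n}. x l \<le> sum b {i..j} / real (Suc j - i)" (is ?lower)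
proof -
  note x_mono = fit[unfolded isotonic_fit_def, THEN conjunct1]
  have split: "sum f {1..j} = sum f {1..i - 1} + sum f {i..j}" if "i \<in> {1..j}"
    for f :: "nat \<Rightarrow> real" and i j
  proof -
    have "{1..j} = {1..i - 1} \<union> {i..j}" "{1..i - 1} \<inter> {i..j} = {}" using that by auto
    then show ?thesis by (simp add: sum.union_disjoint)
  qed
  have le: "sum x {1..k} \<le> sum b {1..k}" if "k \<le> n" for k
    using fit that by (cases "k = 0") (auto simp: isotonic_fit_def)
  show ?upper
  proof -
    obtain j where j: "j \<in> {l..n}" "x j = x l" "j = n \<or> x j < x (Suc j)"
      using block_end_exists[OF x_mono l] by blast
    have eq: "sum x {1..j} = sum b {1..j}" using fit j l by (auto simp: isotonic_fit_def)
    have "sum b {i..j} / real (Suc j - i) \<le> x l" if i: "i \<in> {1..j}" for i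
    proof -
      have "sum b {i..j} \<le> sum x {i..j}"
      proof -
        have "i - 1 \<le> n" using i j by auto
        then show ?thesis
          using split[OF i, of x] split[OF i, of b] eq le[of "i - 1"] by linarith
      qed
      also have "\<dots> \<le> (\<Sum>s\<in>{i..j}. x l)"
        using i j l mono_onD[OF x_mono, of _ j] by (intro sum_mono) auto
      finally show ?thesis using i by (simp add: field_simps)
    qed
    then show ?thesis using j by blast
  qed
  show ?lower
  proof -
    obtain i where i: "i \<in> {1..l}" "x i = x l" "i = 1 \<or> x (i - 1) < x i"
      using block_start_exists[OF x_mono l] by blast
    have eq: "sum x {1..i - 1} = sum b {1..i - 1}"
    proof (cases "i = 1")
      case False
      then show ?thesis using fit i l
        by (auto simp: isotonic_fit_def dest!: bspec[of _ _ "i - 1"])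
    qed simp
    have "x l \<le> sum b {i..j} / real (Suc j - i)" if j: "j \<in> {i..n}" for j
    proof -
      have "(\<Sum>s\<in>{i..j}. x l) \<le> sum x {i..j}"
        using i j l mono_onD[OF x_mono, of i] by (intro sum_mono) auto
      also have "\<dots> \<le> sum b {i..j}"
        using split[of i j x] split[of i j b] eq le[of j] i j by auto
      finally show ?thesis using j by (simp add: field_simps)
    qed
    then show ?thesis using i by blast
  qed
qed

section \<open>The criterion as a function of its second argument\<close>

lemma antimono_set_integrable:
  fixes h :: "real \<Rightarrow> real"
  assumes "antimono h"
  shows "set_integrable lborel {a..b} h"
proof -
  have "mono (\<lambda>x. - h x)" using assms by (auto simp: monotone_def)
  then have "(\<lambda>x. - (- h x)) \<in> borel_measurable borel"
    by (intro borel_measurable_uminus borel_measurable_mono)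
  then have meas: "h \<in> borel_measurable borel" by simp
  show ?thesis
  proof (rule set_integrable_bound)
    show "set_integrable lborel {a..b} (\<lambda>_. \<bar>h a\<bar> + \<bar>h b\<bar>)"
      by (auto simp: set_integrable_def emeasure_lborel_Icc_eq intro!: integrable_real_indicator)
    show "set_borel_measurable lborel {a..b} h"
      using meas by (simp add: set_borel_measurable_def)
    show "AE x in lborel. x \<in> {a..b} \<longrightarrow> norm (h x) \<le> norm (\<bar>h a\<bar> + \<bar>h b\<bar>)"
    proof (intro AE_I2 impI)
      fix x assume "x \<in> {a..b}"
      then have "h b \<le> h x" "h x \<le> h a" using antimonoD[OF assms] by auto
      then show "norm (h x) \<le> norm (\<bar>h a\<bar> + \<bar>h b\<bar>)" by auto
    qed
  qed
qed

lemma antimono_integral_bounds: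
  fixes h :: "real \<Rightarrow> real"
  assumes h: "antimono h" and "u \<le> v"
  shows "h v * (v - u) \<le> (LBINT x=ereal u..ereal v. h x)"
    and "(LBINT x=ereal u..ereal v. h x) \<le> h u * (v - u)"
proof -
  have const: "(LBINT x:{u..v}. c) = c * (v - u)" for c :: real
    using \<open>u \<le> v\<close> by (subst set_integral_const) auto
  have const_int: "set_integrable lborel {u..v} (\<lambda>_. c)" for c :: real
    by (auto simp: set_integrable_def emeasure_lborel_Icc_eq intro!: integrable_real_indicator)
  have "(LBINT x:{u..v}. h v) \<le> (LBINT x:{u..v}. h x)"
    using antimonoD[OF h]
    by (intro set_integral_mono const_int antimono_set_integrable[OF h]) auto
  moreover have "(LBINT x:{u..v}. h x) \<le> (LBINT x:{u..v}. h u)"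
    using antimonoD[OF h]
    by (intro set_integral_mono const_int antimono_set_integrable[OF h]) auto
  ultimately show "h v * (v - u) \<le> (LBINT x=ereal u..ereal v. h x)"
    and "(LBINT x=ereal u..ereal v. h x) \<le> h u * (v - u)"
    using \<open>u \<le> v\<close> by (simp_all add: const interval_integral_Icc)
qed

text \<open>Since \<open>h\<close> decreases, \<open>int_h h\<close> is concave with supergradient \<open>h\<close>. As a consequence
  \<open>int_h h r + h r * (a - r)\<close>, viewed as a score for the forecast \<open>r\<close> of the number \<open>a\<close>, is
  minimal at \<open>r = a\<close>.\<close>

lemma int_h_supergradient:
  assumes h: "antimono h"
  shows "int_h h a \<le> int_h h r + h r * (a - r)"
proof -
  let ?u = "min 0 (min r a)" and ?v = "max 0 (max r a)"
  have "set_integrable lborel {?u<..<?v} h"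
    by (rule set_integrable_subset[OF antimono_set_integrable[OF h, of ?u ?v]]) auto
  then have "interval_lebesgue_integrable lborel
      (min (ereal 0) (min (ereal r) (ereal a))) (max (ereal 0) (max (ereal r) (ereal a))) h"
    by (auto simp: interval_lebesgue_integrable_def simp flip: ereal_min ereal_max)
  from interval_integral_sum[OF this]
  have diff: "int_h h a = int_h h r + (LBINT x=ereal r..ereal a. h x)"
    by (simp add: int_h_def)
  show ?thesis
  proof (cases "r \<le> a")
    case True
    then show ?thesis using antimono_integral_bounds(2)[OF h True] diff by simp
  next
    case False
    then have "a \<le> r" by simp
    have "(LBINT x=ereal r..ereal a. h x) = - (LBINT x=ereal a..ereal r. h x)"
      by (rule interval_integral_endpoints_reverse)
    then show ?thesis
      using antimono_integral_bounds(1)[OF h \<open>a \<le> r\<close>] diff by (simp add: algebra_simps)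
  qed
qed

text \<open>Strictness comes from passing through the midpoint \<open>m\<close>
  of \<open>a\<close> and \<open>r\<close>: following the tangent at \<open>r\<close> up to \<open>m\<close> and
  the tangent at \<open>m\<close> from there to \<open>a\<close> ends \<open>(h r - h m) * (a - m) > 0\<close> below the tangent at \<open>r\<close>.\<close>

lemma int_h_supergradient_strict:
  assumes "strict_antimono_on UNIV h" "a \<noteq> r"
  shows "int_h h a < int_h h r + h r * (a - r)"
proof -
  have anti: "antimono h"
    using assms(1) by (auto simp: monotone_on_def order_le_less)
  define m where "m = (a + r) / 2"
  have "(h m - h r) * (a - m) < 0"
  proof (cases "a < r")
    case True
    then have "h m > h r" "a < m" using assms(1) by (auto simp: m_def monotone_on_def)
    then show ?thesis by (auto simp: mult_less_0_iff)
  next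
    case False
    then have "h m < h r" "a > m" using assms by (auto simp: m_def monotone_on_def)
    then show ?thesis by (auto simp: mult_less_0_iff)
  qed
  then show ?thesis
    using int_h_supergradient[OF anti, of a m] int_h_supergradient[OF anti, of m r]
    by (simp add: algebra_simps)
qed

text \<open>Summation by parts writes the sum as \<open>u n * sum d {1..n}\<close> minus the sum of
  \<open>(u (Suc k) - u k) * sum d {1..k}\<close>, and each of these terms is nonnegative.\<close>

lemma sum_by_parts_monotone_weights:
  fixes d u :: "nat \<Rightarrow> real"
  assumes "\<And>k. k \<in> {1..<n} \<Longrightarrow> u k \<le> u (Suc k)"
    and "\<And>k. k \<in> {1..<n} \<Longrightarrow> 0 \<le> sum d {1..k}"
  shows "(\<Sum>s=1..n. u s * d s) \<le> u n * sum d {1..n}"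
  using assms
proof (induction n)
  case 0
  then show ?case by simp
next
  case (Suc n)
  have "(\<Sum>s=1..Suc n. u s * d s) \<le> u n * sum d {1..n} + u (Suc n) * d (Suc n)"
    using Suc by simp
  also have "u n * sum d {1..n} \<le> u (Suc n) * sum d {1..n}"
    using Suc.prems[of n] by (cases "n = 0") (auto intro!: mult_right_mono)
  finally show ?case by (simp add: algebra_simps)
qed

lemma sum_by_parts_block_weights:
  fixes d u :: "nat \<Rightarrow> real"
  assumes "\<And>k. k \<in> {1..<n} \<Longrightarrow> u k = u (Suc k) \<or> sum d {1..k} = 0"
  shows "(\<Sum>s=1..n. u s * d s) = u n * sum d {1..n}"
  using assms
proof (induction n)
  case 0
  then show ?case by simp
next
  case (Suc n)
  have "(\<Sum>s=1..Suc n. u s * d s) = u n * sum d {1..n} + u (Suc n) * d (Suc n)"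
    using Suc by simp
  also have "u n * sum d {1..n} = u (Suc n) * sum d {1..n}"
    using Suc.prems[of n] by (cases "n = 0") auto
  finally show ?case by (simp add: algebra_simps)
qed

text \<open>The excess of \<open>\<gamma>\<close> over the fit splits into the pointwise excess of the score when the observation
  \<open>a s\<close> is replaced by the fitted value \<open>- x s\<close>, which is the second sum on the left, and the
  correction \<open>(h (\<gamma> s) - h (- x s)) * (a s + x s)\<close>. Summed over \<open>s\<close> the correction is nonnegative:
  \<open>h \<circ> \<gamma>\<close> increases while the partial sums of \<open>- a s - x s\<close> are nonnegative with total zero, and
  \<open>h (- x s)\<close> changes only where these partial sums vanish.\<close>

lemma criterion_gap:
  fixes a x \<gamma> h :: "_ \<Rightarrow> real"
  assumes h: "antimono h" and fit: "isotonic_fit 1 n (\<lambda>s. - a s) x"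
    and g: "antimono_on {1..n} \<gamma>"
  shows "(\<Sum>s=1..n. int_h h (- x s) + h (- x s) * (a s + x s))
      + (\<Sum>s=1..n. int_h h (\<gamma> s) + h (\<gamma> s) * (- x s - \<gamma> s) - int_h h (- x s))
    \<le> (\<Sum>s=1..n. int_h h (\<gamma> s) + h (\<gamma> s) * (a s - \<gamma> s))"
proof -
  define d where "d s = - a s - x s" for s
  have d: "sum d {1..k} = sum (\<lambda>s. - a s) {1..k} - sum x {1..k}" for k
    unfolding d_def by (simp only: sum_subtractf)
  have total: "sum d {1..n} = 0"
    using fit unfolding d by (cases "n = 0") (auto simp: isotonic_fit_def)
  have "(\<Sum>s=1..n. h (\<gamma> s) * d s) \<le> h (\<gamma> n) * sum d {1..n}"
  proof (rule sum_by_parts_monotone_weights)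
    fix k assume k: "k \<in> {1..<n}"
    show "h (\<gamma> k) \<le> h (\<gamma> (Suc k))"
      using g k by (intro antimonoD[OF h]) (auto simp: monotone_on_def)
    show "0 \<le> sum d {1..k}" using fit k unfolding d by (auto simp: isotonic_fit_def)
  qed
  moreover have "(\<Sum>s=1..n. h (- x s) * d s) = h (- x n) * sum d {1..n}"
  proof (rule sum_by_parts_block_weights)
    fix k assume k: "k \<in> {1..<n}"
    have "x k \<le> x (Suc k)" using fit k by (auto simp: isotonic_fit_def monotone_on_def)
    then show "h (- x k) = h (- x (Suc k)) \<or> sum d {1..k} = 0"
      using fit k unfolding d by (auto simp: isotonic_fit_def order_le_less)
  qed
  ultimately have "(\<Sum>s=1..n. h (\<gamma> s) * d s) \<le> (\<Sum>s=1..n. h (- x s) * d s)"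
    using total by simp
  then show ?thesis
    by (simp add: d_def algebra_simps sum.distrib sum_subtractf sum_negf)
qed

section \<open>Isotonic optimization with threshold losses\<close>

text \<open>Here \<open>cost s\<close> stands for a weighted loss at observation \<open>s\<close> and \<open>D s c\<close> for a weighted
  identification function: the sign of a sum of \<open>D s c\<close> at one point \<open>c\<close> controls the sum of costs
  everywhere to the left of \<open>c\<close>. The numbers \<open>\<tau> i j\<close> are the thresholds below which the block
  \<open>{i..j}\<close> wants to move up.

  The conclusion holds because otherwise some block \<open>{i..j}\<close> can be raised to a common value \<open>c\<close>
  with strict gain. The index \<open>j\<close> cannot simply be the end of the level set of \<open>x l\<close>: the next level
  may be so close that no cost changes in between. Therefore \<open>j\<close> is the last index before a change of
  value that some cost notices. The index \<open>i\<close> needs care because the values \<open>x s\<close> on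
  \<open>{i..j}\<close> need not be equal. It is chosen to minimize the sum of \<open>D s c\<close> over \<open>{i..j}\<close>, so that all
  initial segments \<open>{i..k}\<close> have nonpositive sum and thus do not lose when they are lifted to the
  value of their right neighbour.\<close>

lemma isotonic_optimum_lower_bound:
  fixes D cost :: "nat \<Rightarrow> real \<Rightarrow> real" and \<tau> :: "nat \<Rightarrow> nat \<Rightarrow> ereal" and x :: "nat \<Rightarrow> real"
  assumes cost_antimono:
      "\<And>A a b c. \<lbrakk>A \<subseteq> {1..n}; a \<le> b; b \<le> c; (\<Sum>s\<in>A. D s c) \<le> 0\<rbrakk>
        \<Longrightarrow> (\<Sum>s\<in>A. cost s b) \<le> (\<Sum>s\<in>A. cost s a)"
    and cost_strict:
      "\<And>A a b c t. \<lbrakk>A \<subseteq> {1..n}; a \<le> b; b \<le> c; (\<Sum>s\<in>A. D s c) < 0;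
          t \<in> {1..n}; cost t a \<noteq> cost t b\<rbrakk>
        \<Longrightarrow> (\<Sum>s\<in>A. cost s b) < (\<Sum>s\<in>A. cost s a)"
    and below_\<tau>:
      "\<And>i j c. \<lbrakk>i \<in> {1..j}; j \<in> {1..n}; ereal c < \<tau> i j\<rbrakk> \<Longrightarrow> (\<Sum>s=i..j. D s c) < 0"
    and improve:
      "\<And>i j c. \<lbrakk>i \<in> {1..j}; j \<in> {1..n}; ereal c < \<tau> i j\<rbrakk>
        \<Longrightarrow> \<exists>b>c. ereal b \<le> \<tau> i j \<and> (\<Sum>s=i..j. D s b) \<le> 0 \<and>
            (\<Sum>s=i..j. cost s b) < (\<Sum>s=i..j. cost s c)"
    and x_mono: "mono_on {1..n} x"
    and x_opt: "\<And>x'. mono_on {1..n} x' \<Longrightarrow> (\<Sum>s=1..n. cost s (x s)) \<le> (\<Sum>s=1..n. cost s (x' s))"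
    and l: "l \<in> {1..n}"
  shows "\<exists>j\<in>{l..n}. \<forall>i\<in>{1..j}. \<tau> i j \<le> ereal (x l)"
proof (rule ccontr)
  assume "\<not> ?thesis"
  then have large: "\<exists>i\<in>{1..j}. ereal (x l) < \<tau> i j" if "j \<in> {l..n}" for j
    using that by (auto simp: not_le)
  define flat where "flat b \<longleftrightarrow> (\<forall>s\<in>{1..n}. \<forall>u\<in>{x l..b}. cost s u = cost s (x l))" for b
  let ?J = "{j \<in> {l..n}. flat (x j)}"
  define j where "j = Max ?J"
  have "l \<in> ?J" using l by (auto simp: flat_def)
  then have "j \<in> ?J" unfolding j_def by (intro Max_in) auto
  then have j: "j \<in> {l..n}" and flat_j: "flat (x j)" by auto
  have not_flat: "\<not> flat (x (Suc j))" if "j < n"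
  proof
    assume "flat (x (Suc j))"
    then have "Suc j \<in> ?J" using that j by auto
    then have "Suc j \<le> j" using Max_ge[of ?J "Suc j"] unfolding j_def by auto
    then show False by simp
  qed
  have x_le: "x r \<le> x s" if "1 \<le> r" "r \<le> s" "s \<le> n" for r s
    using that by (intro mono_onD[OF x_mono]) auto
  have flat_eq: "cost s u = cost s (x j)" if "s \<in> {1..n}" "x l \<le> u" "u \<le> x j" for s u
  proof -
    have "cost s v = cost s (x l)" if "v \<in> {x l..x j}" for v
      using flat_j that \<open>s \<in> {1..n}\<close> unfolding flat_def by blast
    from this[of u] this[of "x j"] show ?thesis using that x_le[of l j] j l by auto
  qed
  have at_x_l: "cost s (x l) = cost s (x j)" if "s \<in> {1..n}" for s
    using that x_le[of l j] j l by (intro flat_eq) auto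
  obtain i0 where i0: "i0 \<in> {1..j}" "ereal (x l) < \<tau> i0 j" using large[OF j] by blast
  have sub: "{i..j} \<subseteq> {1..n}" if "i \<in> {1..j}" for i using that j by auto
  \<comment> \<open>The target value: a strictly better value for \<open>{i0..j}\<close>, cut off at \<open>x (Suc j)\<close> to keep
    the modified sequence isotonic.\<close>
  obtain c where c: "x j < c" "j < n \<Longrightarrow> c \<le> x (Suc j)" "(\<Sum>s=i0..j. D s c) \<le> 0"
      "(\<Sum>s=i0..j. cost s c) < (\<Sum>s=i0..j. cost s (x j))"
  proof -
    have "\<exists>b>x l. ereal b \<le> \<tau> i0 j \<and> (\<Sum>s=i0..j. D s b) \<le> 0 \<and>
            (\<Sum>s=i0..j. cost s b) < (\<Sum>s=i0..j. cost s (x l))"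
      by (rule improve) (use i0 j l in auto)
    then obtain b where b: "x l < b" "ereal b \<le> \<tau> i0 j" "(\<Sum>s=i0..j. D s b) \<le> 0"
        "(\<Sum>s=i0..j. cost s b) < (\<Sum>s=i0..j. cost s (x l))" by blast
    have at_l: "(\<Sum>s=i0..j. cost s (x l)) = (\<Sum>s=i0..j. cost s (x j))"
      using sub[OF i0(1)] by (intro sum.cong at_x_l) auto
    have "x j < b"
    proof (rule ccontr)
      assume "\<not> x j < b"
      then have "(\<Sum>s=i0..j. cost s b) = (\<Sum>s=i0..j. cost s (x j))"
        using sub[OF i0(1)] b by (intro sum.cong flat_eq) auto
      then show False using b at_l by simp
    qed
    show ?thesis
    proof (cases "j = n \<or> b \<le> x (Suc j)")
      case True
      then show ?thesis using that[of b] b at_l \<open>x j < b\<close> by auto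
    next
      case False
      let ?G = "x (Suc j)"
      have less: "j < n" "?G < b" using False j by auto
      then have "ereal ?G < \<tau> i0 j" using b(2) order.strict_trans2[of "ereal ?G" "ereal b"] by simp
      then have neg: "(\<Sum>s=i0..j. D s ?G) < 0" using i0 j by (intro below_\<tau>) auto
      obtain s u where s: "s \<in> {1..n}" and u: "x l \<le> u" "u \<le> ?G" "cost s u \<noteq> cost s (x l)"
        using not_flat[OF less(1)] by (auto simp: flat_def)
      have "x j < u"
      proof (rule ccontr)
        assume "\<not> x j < u"
        then have "cost s u = cost s (x j)" using flat_eq[OF s u(1)] by simp
        then show False using at_x_l[OF s] u(3) by simp
      qed
      have "(\<Sum>s=i0..j. cost s ?G) \<le> (\<Sum>s=i0..j. cost s u)"
        using sub[OF i0(1)] neg u by (intro cost_antimono[where c = ?G]) auto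
      also have "\<dots> < (\<Sum>s=i0..j. cost s (x j))"
        using sub[OF i0(1)] neg u s \<open>x j < u\<close> at_x_l[OF s]
        by (intro cost_strict[where c = ?G and t = s]) auto
      finally show ?thesis using that[of ?G] neg u \<open>x j < u\<close> by auto
    qed
  qed
  obtain t where t: "t \<in> {1..n}" "cost t (x j) \<noteq> cost t c"
  proof -
    have "\<exists>t\<in>{i0..j}. cost t (x j) \<noteq> cost t c"
    proof (rule ccontr)
      assume "\<not> ?thesis"
      then have "(\<Sum>s=i0..j. cost s c) = (\<Sum>s=i0..j. cost s (x j))"
        by (intro sum.cong) auto
      then show False using c(4) by simp
    qed
    then show ?thesis using that sub[OF i0(1)] by blast
  qed
  define U where "U i = (\<Sum>s=i..j. D s c)" for i
  obtain i where i: "i \<in> {1..j}" and U_min: "\<And>k. k \<in> {1..j} \<Longrightarrow> U i \<le> U k"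
    and U_le: "U i \<le> 0" and gain: "(\<Sum>s=i..j. cost s c) < (\<Sum>s=i..j. cost s (x j))"
  proof -
    obtain i1 where i1: "i1 \<in> {1..j}" "\<And>k. k \<in> {1..j} \<Longrightarrow> U i1 \<le> U k"
      using ex_min_if_finite[of "U ` {1..j}"] i0 by (auto simp: not_less)
    have U_i0: "U i0 \<le> 0" using c(3) by (simp add: U_def)
    show ?thesis
    \<comment> \<open>If the minimum is negative, the minimizer gains strictly. If it is zero, then \<open>i0\<close> is
      a minimizer as well, and for \<open>i0\<close> the strict gain is known.\<close>
    proof (cases "U i1 < 0")
      case True
      have "(\<Sum>s=i1..j. cost s c) < (\<Sum>s=i1..j. cost s (x j))"
        using True sub[OF i1(1)] c t
        by (intro cost_strict[where c = c and t = t]) (auto simp: U_def)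
      then show ?thesis using that[of i1] i1 True by auto
    next
      case False
      then have "U i0 \<le> U k" if "k \<in> {1..j}" for k
        using U_i0 i1(2)[OF that] by linarith
      then show ?thesis using that[of i0] i0 U_i0 c(4) by auto
    qed
  qed
  have partial: "(\<Sum>s=i..k. D s c) \<le> 0" if k: "k \<in> {i..j}" for k
  proof (cases "k = j")
    case True
    then show ?thesis using U_le by (simp add: U_def)
  next
    case False
    have "U i = (\<Sum>s=i..k. D s c) + U (Suc k)"
      using sum.ub_add_nat[of i k "\<lambda>s. D s c" "j - k"] k by (simp add: U_def)
    then show ?thesis using U_min[of "Suc k"] False k by auto
  qed
  \<comment> \<open>Lifting step by step: \<open>{i..k}\<close> moves from \<open>x k\<close> to \<open>x (Suc k)\<close> and absorbs \<open>Suc k\<close>.\<close>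
  have pool: "(\<Sum>s=i..k. cost s (x k)) \<le> (\<Sum>s=i..k. cost s (x s))" if "i \<le> k" "k \<le> j" for k
    using that
  proof (induction k rule: dec_induct)
    case base
    then show ?case by simp
  next
    case (step k)
    have "(\<Sum>s=i..k. cost s (x (Suc k))) \<le> (\<Sum>s=i..k. cost s (x k))"
      using partial[of k] step i j c(1) x_le[of "Suc k" j] x_le[of k "Suc k"]
      by (intro cost_antimono[where c = c]) auto
    then show ?case using step by simp
  qed
  define x' where "x' s = (if s \<in> {i..j} then c else x s)" for s
  have "mono_on {1..n} x'"
  proof (rule mono_onI)
    fix r s assume rs: "r \<in> {1..n}" "s \<in> {1..n}" "r \<le> s"
    have "x r \<le> c" if "r \<le> j" using that x_le[of r j] rs j c(1) by auto
    moreover have "c \<le> x s" if "j < s" using that x_le[of "Suc j" s] rs j c(2) by auto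
    moreover have "x r \<le> x s" using x_le rs by auto
    ultimately show "x' r \<le> x' s" using rs by (auto simp: x'_def)
  qed
  from x_opt[OF this] have "0 \<le> (\<Sum>s=1..n. cost s (x' s) - cost s (x s))"
    by (simp add: sum_subtractf)
  also have "\<dots> = (\<Sum>s=i..j. cost s (x' s) - cost s (x s))"
    using sub[OF i] by (intro sum.mono_neutral_right) (auto simp: x'_def)
  also have "\<dots> = (\<Sum>s=i..j. cost s c) - (\<Sum>s=i..j. cost s (x s))"
    by (simp add: sum_subtractf x'_def)
  also have "\<dots> < 0" using gain pool[of j] i by auto
  finally show False by simp
qed

text \<open>This is the lower bound for the sequence reflected in both directions: the index \<open>s\<close> becomes
  \<open>Suc n - s\<close> and the value \<open>u\<close> becomes \<open>- u\<close>.\<close>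

lemma isotonic_optimum_upper_bound:
  fixes D cost :: "nat \<Rightarrow> real \<Rightarrow> real" and \<tau> :: "nat \<Rightarrow> nat \<Rightarrow> ereal" and x :: "nat \<Rightarrow> real"
  assumes cost_mono:
      "\<And>A a b c. \<lbrakk>A \<subseteq> {1..n}; c \<le> a; a \<le> b; 0 \<le> (\<Sum>s\<in>A. D s c)\<rbrakk>
        \<Longrightarrow> (\<Sum>s\<in>A. cost s a) \<le> (\<Sum>s\<in>A. cost s b)"
    and cost_strict:
      "\<And>A a b c t. \<lbrakk>A \<subseteq> {1..n}; c \<le> a; a \<le> b; 0 < (\<Sum>s\<in>A. D s c);
          t \<in> {1..n}; cost t a \<noteq> cost t b\<rbrakk>
        \<Longrightarrow> (\<Sum>s\<in>A. cost s a) < (\<Sum>s\<in>A. cost s b)"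
    and above_\<tau>:
      "\<And>i j c. \<lbrakk>i \<in> {1..n}; j \<in> {i..n}; \<tau> i j < ereal c\<rbrakk> \<Longrightarrow> 0 < (\<Sum>s=i..j. D s c)"
    and improve:
      "\<And>i j c. \<lbrakk>i \<in> {1..n}; j \<in> {i..n}; \<tau> i j < ereal c\<rbrakk>
        \<Longrightarrow> \<exists>a<c. \<tau> i j \<le> ereal a \<and> 0 \<le> (\<Sum>s=i..j. D s a) \<and>
            (\<Sum>s=i..j. cost s a) < (\<Sum>s=i..j. cost s c)"
    and x_mono: "mono_on {1..n} x"
    and x_opt: "\<And>x'. mono_on {1..n} x' \<Longrightarrow> (\<Sum>s=1..n. cost s (x s)) \<le> (\<Sum>s=1..n. cost s (x' s))"
    and l: "l \<in> {1..n}"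
  shows "\<exists>i\<in>{1..l}. \<forall>j\<in>{i..n}. ereal (x l) \<le> \<tau> i j"
proof -
  define \<rho> where "\<rho> s = Suc n - s" for s
  have \<rho>_in: "\<rho> s \<in> {1..n}" if "s \<in> {1..n}" for s using that by (auto simp: \<rho>_def)
  have \<rho>_\<rho>: "\<rho> (\<rho> s) = s" if "s \<in> {1..n}" for s using that by (auto simp: \<rho>_def)
  have reindex: "(\<Sum>s\<in>A. f (\<rho> s)) = (\<Sum>s\<in>\<rho> ` A. f s)" if "A \<subseteq> {1..n}"
    for A and f :: "nat \<Rightarrow> real"
    using that \<rho>_\<rho> by (subst sum.reindex) (auto simp: inj_on_def subset_iff, metis)
  have image_Icc: "\<rho> ` {i..j} = {\<rho> j..\<rho> i}" if "i \<in> {1..j}" "j \<in> {1..n}" for i j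
  proof (intro set_eqI iffI)
    fix s assume "s \<in> {\<rho> j..\<rho> i}"
    then have "\<rho> s \<in> {i..j}" "\<rho> (\<rho> s) = s" using that by (auto simp: \<rho>_def)
    then show "s \<in> \<rho> ` {i..j}" by (metis image_eqI)
  qed (use that in \<open>auto simp: \<rho>_def\<close>)
  have reindex_Icc: "(\<Sum>s=i..j. f (\<rho> s)) = (\<Sum>s=\<rho> j..\<rho> i. f s)"
    if "i \<in> {1..j}" "j \<in> {1..n}" for i j and f :: "nat \<Rightarrow> real"
    using reindex[of "{i..j}" f] image_Icc[OF that] that by auto
  have \<rho>_range: "\<rho> j \<in> {1..n}" "\<rho> i \<in> {\<rho> j..n}" if "i \<in> {1..j}" "j \<in> {1..n}" for i j
    using that by (auto simp: \<rho>_def)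
  have sub: "\<rho> ` A \<subseteq> {1..n}" if "A \<subseteq> {1..n}" for A using that \<rho>_in by blast
  have all: "(\<Sum>s=1..n. f (\<rho> s)) = (\<Sum>s=1..n. f s)" for f :: "nat \<Rightarrow> real"
    using reindex_Icc[of 1 n f] by (cases "n = 0") (auto simp: \<rho>_def)
  have "\<exists>j\<in>{\<rho> l..n}. \<forall>i\<in>{1..j}. - \<tau> (\<rho> j) (\<rho> i) \<le> ereal (- x (\<rho> (\<rho> l)))"
  proof (rule isotonic_optimum_lower_bound[where D = "\<lambda>s c. - D (\<rho> s) (- c)"
        and cost = "\<lambda>s c. cost (\<rho> s) (- c)" and \<tau> = "\<lambda>i j. - \<tau> (\<rho> j) (\<rho> i)"
        and x = "\<lambda>s. - x (\<rho> s)" and l = "\<rho> l"])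
    fix A a b c assume A: "A \<subseteq> {1..n}" "a \<le> b" "b \<le> c" "(\<Sum>s\<in>A. - D (\<rho> s) (- c)) \<le> 0"
    show "(\<Sum>s\<in>A. cost (\<rho> s) (- b)) \<le> (\<Sum>s\<in>A. cost (\<rho> s) (- a))"
      unfolding reindex[OF A(1), of "\<lambda>s. cost s _"]
      by (rule cost_mono[where c = "- c"])
        (use A sub[OF A(1)] reindex[OF A(1), of "\<lambda>s. D s (- c)"] in \<open>auto simp: sum_negf\<close>)
  next
    fix A a b c t assume A: "A \<subseteq> {1..n}" "a \<le> b" "b \<le> c" "(\<Sum>s\<in>A. - D (\<rho> s) (- c)) < 0"
      and t: "t \<in> {1..n}" "cost (\<rho> t) (- a) \<noteq> cost (\<rho> t) (- b)"
    show "(\<Sum>s\<in>A. cost (\<rho> s) (- b)) < (\<Sum>s\<in>A. cost (\<rho> s) (- a))"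
      unfolding reindex[OF A(1), of "\<lambda>s. cost s _"]
      by (rule cost_strict[where c = "- c" and t = "\<rho> t"])
        (use A t \<rho>_in[OF t(1)] sub[OF A(1)] reindex[OF A(1), of "\<lambda>s. D s (- c)"]
          in \<open>auto simp: sum_negf\<close>)
  next
    fix i j c assume ij: "i \<in> {1..j}" "j \<in> {1..n}" and c: "ereal c < - \<tau> (\<rho> j) (\<rho> i)"
    have c': "\<tau> (\<rho> j) (\<rho> i) < ereal (- c)"
      using c by (cases "\<tau> (\<rho> j) (\<rho> i)") auto
    show "(\<Sum>s=i..j. - D (\<rho> s) (- c)) < 0"
      using above_\<tau>[OF \<rho>_range[OF ij] c'] reindex_Icc[OF ij, of "\<lambda>s. D s (- c)"]
      by (simp add: sum_negf)
    obtain a where a: "a < - c" "\<tau> (\<rho> j) (\<rho> i) \<le> ereal a" "0 \<le> (\<Sum>s=\<rho> j..\<rho> i. D s a)"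
        "(\<Sum>s=\<rho> j..\<rho> i. cost s a) < (\<Sum>s=\<rho> j..\<rho> i. cost s (- c))"
      using improve[OF \<rho>_range[OF ij] c'] by blast
    show "\<exists>b>c. ereal b \<le> - \<tau> (\<rho> j) (\<rho> i) \<and> (\<Sum>s=i..j. - D (\<rho> s) (- b)) \<le> 0 \<and>
        (\<Sum>s=i..j. cost (\<rho> s) (- b)) < (\<Sum>s=i..j. cost (\<rho> s) (- c))"
    proof (intro exI[of _ "- a"] conjI)
      show "ereal (- a) \<le> - \<tau> (\<rho> j) (\<rho> i)"
        using a(2) by (cases "\<tau> (\<rho> j) (\<rho> i)") auto
    qed (use a reindex_Icc[OF ij, of "\<lambda>s. D s a"] reindex_Icc[OF ij, of "\<lambda>s. cost s _"]
        in \<open>auto simp: sum_negf\<close>)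
  next
    show "mono_on {1..n} (\<lambda>s. - x (\<rho> s))"
      by (intro mono_onI) (auto simp: \<rho>_def intro!: mono_onD[OF x_mono])
  next
    fix x' :: "nat \<Rightarrow> real" assume x': "mono_on {1..n} x'"
    have "mono_on {1..n} (\<lambda>s. - x' (\<rho> s))"
      by (intro mono_onI) (auto simp: \<rho>_def intro!: mono_onD[OF x'])
    from x_opt[OF this]
    have "(\<Sum>s=1..n. cost s (x s)) \<le> (\<Sum>s=1..n. cost s (- x' (\<rho> s)))" .
    also have "\<dots> = (\<Sum>s=1..n. cost (\<rho> s) (- x' (\<rho> (\<rho> s))))"
      using all[of "\<lambda>s. cost s (- x' (\<rho> s))"] by simp
    also have "\<dots> = (\<Sum>s=1..n. cost (\<rho> s) (- x' s))"
      by (intro sum.cong) (auto simp: \<rho>_\<rho>)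
    finally show "(\<Sum>s=1..n. cost (\<rho> s) (- (- x (\<rho> s)))) \<le> (\<Sum>s=1..n. cost (\<rho> s) (- x' s))"
      using all[of "\<lambda>s. cost s (x s)"] by simp
  qed (use \<rho>_in l in auto)
  then obtain j where j: "j \<in> {\<rho> l..n}"
    and le: "\<And>i. i \<in> {1..j} \<Longrightarrow> - \<tau> (\<rho> j) (\<rho> i) \<le> ereal (- x l)"
    using \<rho>_\<rho>[OF l] by auto
  have "ereal (x l) \<le> \<tau> (\<rho> j) k" if k: "k \<in> {\<rho> j..n}" for k
  proof -
    have "\<rho> k \<in> {1..j}" "\<rho> (\<rho> k) = k" using k j l by (auto simp: \<rho>_def)
    then have "- \<tau> (\<rho> j) k \<le> ereal (- x l)" using le[of "\<rho> k"] by simp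
    then show ?thesis by (cases "\<tau> (\<rho> j) k") auto
  qed
  moreover have "\<rho> j \<in> {1..l}" using j l by (auto simp: \<rho>_def)
  ultimately show ?thesis by blast
qed

section \<open>Losses generated by an identification function\<close>

text \<open>A difference of losses at two arguments is an integral of \<open>V\<close> over the interval between them.
  One measure serves all intervals, index sets and observations, which is what allows
  conclusions from a weighted sum to a single loss.\<close>

lemma loss_sum_increment:
  fixes w v :: "'i \<Rightarrow> real"
  assumes "L \<in> loss_class V"
  shows "\<exists>H1 :: real measure.
    (\<forall>a b u. a \<le> b \<longrightarrow> L b u - L a u = (LINT \<eta>|H1. indicator {a<..b} \<eta> * V \<eta> u)) \<and>
    (\<forall>A a b. a \<le> b \<longrightarrow>
      integrable H1 (\<lambda>\<eta>. indicator {a<..b} \<eta> * (\<Sum>s\<in>A. w s * V \<eta> (v s))) \<and>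
      (\<Sum>s\<in>A. w s * L b (v s)) - (\<Sum>s\<in>A. w s * L a (v s))
        = (LINT \<eta>|H1. indicator {a<..b} \<eta> * (\<Sum>s\<in>A. w s * V \<eta> (v s))))"
proof -
  obtain H1 :: "real measure" where
    int: "\<And>x u. integrable H1 (\<lambda>\<eta>. (indicator {..x} \<eta> - indicator {..u} \<eta>) * V \<eta> u)" and
    L: "\<And>x u. L x u = (LINT \<eta>|H1. (indicator {..x} \<eta> - indicator {..u} \<eta>) * V \<eta> u)"
    using assms by (auto simp: loss_class_def)
  have ind: "indicator {a<..b} \<eta> * r = (indicator {..b} \<eta> - indicator {..u} \<eta>) * r
      - (indicator {..a} \<eta> - indicator {..u} \<eta>) * r" if "a \<le> b" for a b u \<eta> r :: real
    using that by (auto simp: indicator_def)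
  have single_int: "integrable H1 (\<lambda>\<eta>. indicator {a<..b} \<eta> * V \<eta> u)" if "a \<le> b" for a b u
    unfolding ind[OF that, of _ _ u] by (intro Bochner_Integration.integrable_diff int)
  have single: "L b u - L a u = (LINT \<eta>|H1. indicator {a<..b} \<eta> * V \<eta> u)" if "a \<le> b" for a b u
    unfolding ind[OF that, of _ _ u] L
    by (rule Bochner_Integration.integral_diff[symmetric]) (rule int)+
  have rearrange: "indicator {a<..b} \<eta> * (\<Sum>s\<in>A. w s * V \<eta> (v s))
      = (\<Sum>s\<in>A. w s * (indicator {a<..b} \<eta> * V \<eta> (v s)))" for a b \<eta> :: real and A
    by (simp add: sum_distrib_left mult.left_commute)
  show ?thesis
  proof (intro exI[of _ H1] conjI allI impI)
    fix a b u :: real assume "a \<le> b"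
    then show "L b u - L a u = (LINT \<eta>|H1. indicator {a<..b} \<eta> * V \<eta> u)" by (rule single)
  next
    fix A and a b :: real assume ab: "a \<le> b"
    have "(LINT \<eta>|H1. (\<Sum>s\<in>A. w s * (indicator {a<..b} \<eta> * V \<eta> (v s))))
        = (\<Sum>s\<in>A. w s * (L b (v s) - L a (v s)))"
      by (subst Bochner_Integration.integral_sum)
        (auto intro!: integrable_mult_right single_int[OF ab] simp: single[OF ab])
    then show "(\<Sum>s\<in>A. w s * L b (v s)) - (\<Sum>s\<in>A. w s * L a (v s))
        = (LINT \<eta>|H1. indicator {a<..b} \<eta> * (\<Sum>s\<in>A. w s * V \<eta> (v s)))"
      unfolding rearrange by (simp add: sum_subtractf right_diff_distrib)
    show "integrable H1 (\<lambda>\<eta>. indicator {a<..b} \<eta> * (\<Sum>s\<in>A. w s * V \<eta> (v s)))"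
      unfolding rearrange
      by (intro Bochner_Integration.integrable_sum integrable_mult_right single_int[OF ab])
  qed
qed

lemma loss_sum_antimono:
  fixes w v :: "'i \<Rightarrow> real"
  assumes "L \<in> loss_class V" "a \<le> b"
    and "\<And>\<eta>. \<eta> \<in> {a<..b} \<Longrightarrow> (\<Sum>s\<in>A. w s * V \<eta> (v s)) \<le> 0"
  shows "(\<Sum>s\<in>A. w s * L b (v s)) \<le> (\<Sum>s\<in>A. w s * L a (v s))"
proof -
  obtain H1 :: "real measure" where H1: "(\<Sum>s\<in>A. w s * L b (v s)) - (\<Sum>s\<in>A. w s * L a (v s))
        = (LINT \<eta>|H1. indicator {a<..b} \<eta> * (\<Sum>s\<in>A. w s * V \<eta> (v s)))"
    using loss_sum_increment[OF assms(1), of w v] assms(2) by blast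
  have "0 \<le> (LINT \<eta>|H1. - (indicator {a<..b} \<eta> * (\<Sum>s\<in>A. w s * V \<eta> (v s))))"
    using assms(3) by (intro Bochner_Integration.integral_nonneg) (auto simp: indicator_def)
  then show ?thesis using H1 by simp
qed

text \<open>If some loss differs at \<open>a\<close> and \<open>b\<close>, the interval between them cannot be a null set. A negative
  integrand on it then gives a negative integral.\<close>

lemma loss_sum_strict_antimono:
  fixes w v :: "'i \<Rightarrow> real"
  assumes L: "L \<in> loss_class V" and ab: "a \<le> b"
    and neg: "\<And>\<eta>. \<eta> \<in> {a<..b} \<Longrightarrow> (\<Sum>s\<in>A. w s * V \<eta> (v s)) < 0"
    and differs: "L a u \<noteq> L b u"
  shows "(\<Sum>s\<in>A. w s * L b (v s)) < (\<Sum>s\<in>A. w s * L a (v s))"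
proof (rule ccontr)
  assume not_less: "\<not> ?thesis"
  define f where "f \<eta> = - (indicator {a<..b} \<eta> * (\<Sum>s\<in>A. w s * V \<eta> (v s)))" for \<eta> :: real
  obtain H1 :: "real measure" where single:
    "L b u - L a u = (LINT \<eta>|H1. indicator {a<..b} \<eta> * V \<eta> u)"
    and "integrable H1 (\<lambda>\<eta>. indicator {a<..b} \<eta> * (\<Sum>s\<in>A. w s * V \<eta> (v s)))"
    and "(\<Sum>s\<in>A. w s * L b (v s)) - (\<Sum>s\<in>A. w s * L a (v s))
        = (LINT \<eta>|H1. indicator {a<..b} \<eta> * (\<Sum>s\<in>A. w s * V \<eta> (v s)))"
    using loss_sum_increment[OF L, of w v] ab by blast
  then have int: "integrable H1 f"
    and sum: "(\<Sum>s\<in>A. w s * L b (v s)) - (\<Sum>s\<in>A. w s * L a (v s)) = - (LINT \<eta>|H1. f \<eta>)"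
    by (simp_all add: f_def[abs_def])
  have nonneg: "0 \<le> f \<eta>" for \<eta>
    using neg[of \<eta>] by (cases "\<eta> \<in> {a<..b}") (auto simp: f_def)
  have "0 \<le> (LINT \<eta>|H1. f \<eta>)"
    using nonneg by (intro Bochner_Integration.integral_nonneg) auto
  then have "(LINT \<eta>|H1. f \<eta>) = 0" using not_less sum by simp
  then have "AE \<eta> in H1. f \<eta> = 0"
    using integral_nonneg_eq_0_iff_AE[OF int] nonneg by auto
  then have "AE \<eta> in H1. indicator {a<..b} \<eta> * V \<eta> u = 0"
  proof eventually_elim
    case (elim \<eta>)
    show ?case
    proof (cases "\<eta> \<in> {a<..b}")
      case True
      then show ?thesis using neg[OF True] elim by (simp add: f_def)
    qed simp
  qed
  then have "(LINT \<eta>|H1. indicator {a<..b} \<eta> * V \<eta> u) = 0"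
    by (rule integral_eq_zero_AE)
  then show False using single differs by simp
qed

text \<open>The weights in the preceding two lemmas may have any sign, so that the increasing versions follow by
  negating them.\<close>

lemma loss_sum_mono:
  fixes w v :: "'i \<Rightarrow> real"
  assumes "L \<in> loss_class V" "a \<le> b"
    and "\<And>\<eta>. \<eta> \<in> {a<..b} \<Longrightarrow> 0 \<le> (\<Sum>s\<in>A. w s * V \<eta> (v s))"
  shows "(\<Sum>s\<in>A. w s * L a (v s)) \<le> (\<Sum>s\<in>A. w s * L b (v s))"
  using loss_sum_antimono[OF assms(1,2), where w = "\<lambda>s. - w s" and v = v and A = A]
    assms(3) by (simp add: sum_negf)

lemma loss_sum_strict_mono:
  fixes w v :: "'i \<Rightarrow> real"
  assumes "L \<in> loss_class V" "a \<le> b"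
    and "\<And>\<eta>. \<eta> \<in> {a<..b} \<Longrightarrow> 0 < (\<Sum>s\<in>A. w s * V \<eta> (v s))"
    and "L a u \<noteq> L b u"
  shows "(\<Sum>s\<in>A. w s * L a (v s)) < (\<Sum>s\<in>A. w s * L b (v s))"
  using loss_sum_strict_antimono[OF assms(1,2), where w = "\<lambda>s. - w s" and v = v and A = A] assms(3,4)
  by (simp add: sum_negf)

section \<open>The functional induced by an identification function\<close>

lemma expectation_finite_support:
  fixes f :: "real \<Rightarrow> real"
  assumes "finite (set_pmf P)"
  shows "measure_pmf.expectation P f = (\<Sum>u\<in>set_pmf P. pmf P u * f u)"
  using integral_measure_pmf[OF assms, of P f] by simp

lemma V_mean_mono:
  assumes "identification_function V" "finite (set_pmf P)" "a \<le> b"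
  shows "V_mean V a P \<le> V_mean V b P"
  using assms unfolding V_mean_def expectation_finite_support[OF assms(2)]
  by (intro sum_mono mult_left_mono) (auto simp: identification_function_def mono_def)

lemma V_mean_neg_below_T_minus:
  assumes "identification_function V" "finite (set_pmf P)" "ereal c < T_minus V P"
  shows "V_mean V c P < 0"
proof -
  obtain x where "V_mean V x P < 0" "c < x"
    using assms(3) by (auto simp: T_minus_def less_Sup_iff)
  then show ?thesis using V_mean_mono[OF assms(1,2), of c x] by simp
qed

lemma V_mean_pos_above_T_plus:
  assumes "identification_function V" "finite (set_pmf P)" "T_plus V P < ereal c"
  shows "0 < V_mean V c P"
proof -
  obtain x where "0 < V_mean V x P" "x < c"
    using assms(3) by (auto simp: T_plus_def Inf_less_iff)
  then show ?thesis using V_mean_mono[OF assms(1,2), of x c] by simp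
qed

lemma T_minus_le_T_plus:
  assumes "identification_function V" "finite (set_pmf P)"
  shows "T_minus V P \<le> T_plus V P"
  unfolding T_minus_def T_plus_def
proof (intro Sup_least Inf_greatest)
  fix s t assume "s \<in> ereal ` {x. V_mean V x P < 0}" "t \<in> ereal ` {x. 0 < V_mean V x P}"
  then obtain x x' where "s = ereal x" "t = ereal x'" "V_mean V x P < 0" "0 < V_mean V x' P"
    by auto
  then show "s \<le> t" using V_mean_mono[OF assms, of x' x] by (cases "x \<le> x'") auto
qed

lemma Lim_at_top_less:
  fixes f :: "real \<Rightarrow> ereal"
  assumes f: "antimono f" and less: "Lim at_top f < u"
  shows "\<exists>x. f x < u"
proof -
  have "(f \<longlongrightarrow> (INF x. f x)) at_top"
  proof (rule order_tendstoI)
    fix a assume "a < (INF x. f x)"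
    then show "eventually (\<lambda>x. a < f x) at_top"
      by (intro always_eventually allI) (meson INF_lower UNIV_I order.strict_trans2)
  next
    fix a assume "(INF x. f x) < a"
    then obtain x where "f x < a" by (auto simp: INF_less_iff)
    then have "f x' < a" if "x \<le> x'" for x' using antimonoD[OF f that] by simp
    then show "eventually (\<lambda>x. f x < a) at_top" by (auto simp: eventually_at_top_linorder)
  qed
  then have "Lim at_top f = (INF x. f x)" by (intro tendsto_Lim) auto
  then show ?thesis using less by (auto simp: INF_less_iff)
qed

lemma Lim_at_bot_less:
  fixes f :: "real \<Rightarrow> ereal"
  assumes f: "mono f" and less: "Lim at_bot f < u"
  shows "\<exists>x. f x < u"
proof -
  have "(f \<longlongrightarrow> (INF x. f x)) at_bot"
  proof (rule order_tendstoI)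
    fix a assume "a < (INF x. f x)"
    then show "eventually (\<lambda>x. a < f x) at_bot"
      by (intro always_eventually allI) (meson INF_lower UNIV_I order.strict_trans2)
  next
    fix a assume "(INF x. f x) < a"
    then obtain x where "f x < a" by (auto simp: INF_less_iff)
    then have "f x' < a" if "x' \<le> x" for x' using monoD[OF f that] by simp
    then show "eventually (\<lambda>x. f x < a) at_bot" by (auto simp: eventually_at_bot_linorder)
  qed
  then have "Lim at_bot f = (INF x. f x)" by (intro tendsto_Lim) auto
  then show ?thesis using less by (auto simp: INF_less_iff)
qed

text \<open>A value below \<open>T_minus\<close> lies outside the functional, so by strict consistency \<open>T_minus\<close> itself is
  strictly better. If \<open>T_minus\<close> is infinite, the expected loss there is the limit of an antitone
  function, and a number above this limit is above the expected loss at some real argument.\<close>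

lemma improvement_below_T_minus:
  assumes V: "identification_function V" and L: "L \<in> loss_class V"
    and consistent: "strictly_consistent L (T_functional V)"
    and fin: "finite (set_pmf P)" and c: "ereal c < T_minus V P"
  shows "\<exists>b>c. ereal b \<le> T_minus V P \<and>
    measure_pmf.expectation P (L b) < measure_pmf.expectation P (L c)"
proof -
  let ?E = "\<lambda>x. measure_pmf.expectation P (L x)"
  have "T_minus V P \<in> T_functional V P" "ereal c \<notin> T_functional V P"
    using T_minus_le_T_plus[OF V fin] c by (auto simp: T_functional_def)
  then have less: "expected_loss L P (T_minus V P) < ereal (?E c)"
    using consistent fin unfolding strictly_consistent_def by (fastforce simp: expected_loss_def)
  show ?thesis
  proof (cases "T_minus V P")
    case (real r)
    then show ?thesis using less c by (intro exI[of _ r]) (auto simp: expected_loss_def)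
  next
    case PInf
    have anti: "?E b \<le> ?E a" if "a \<le> b" for a b
      unfolding expectation_finite_support[OF fin]
    proof (rule loss_sum_antimono[OF L that])
      fix \<eta>
      show "(\<Sum>u\<in>set_pmf P. pmf P u * V \<eta> u) \<le> 0"
        using V_mean_neg_below_T_minus[OF V fin, of \<eta>] PInf
        by (simp add: V_mean_def expectation_finite_support[OF fin])
    qed
    then have "antimono (\<lambda>x. ereal (?E x))" by (auto intro: antimonoI)
    from Lim_at_top_less[OF this, of "ereal (?E c)"] obtain b where b: "?E b < ?E c"
      using less PInf by (auto simp: expected_loss_def)
    moreover have "c < b" using anti[of b c] b by (cases "b \<le> c") auto
    ultimately show ?thesis using PInf by auto
  next
    case MInf
    then show ?thesis using c by simp
  qed
qed

lemma improvement_above_T_plus: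
  assumes V: "identification_function V" and L: "L \<in> loss_class V"
    and consistent: "strictly_consistent L (T_functional V)"
    and fin: "finite (set_pmf P)" and c: "T_plus V P < ereal c"
  shows "\<exists>a<c. T_plus V P \<le> ereal a \<and>
    measure_pmf.expectation P (L a) < measure_pmf.expectation P (L c)"
proof -
  let ?E = "\<lambda>x. measure_pmf.expectation P (L x)"
  have "T_plus V P \<in> T_functional V P" "ereal c \<notin> T_functional V P"
    using T_minus_le_T_plus[OF V fin] c by (auto simp: T_functional_def)
  then have less: "expected_loss L P (T_plus V P) < ereal (?E c)"
    using consistent fin unfolding strictly_consistent_def by (fastforce simp: expected_loss_def)
  show ?thesis
  proof (cases "T_plus V P")
    case (real r)
    then show ?thesis using less c by (intro exI[of _ r]) (auto simp: expected_loss_def)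
  next
    case MInf
    have mono: "?E a \<le> ?E b" if "a \<le> b" for a b
      unfolding expectation_finite_support[OF fin]
    proof (rule loss_sum_mono[OF L that])
      fix \<eta>
      show "0 \<le> (\<Sum>u\<in>set_pmf P. pmf P u * V \<eta> u)"
        using V_mean_pos_above_T_plus[OF V fin, of \<eta>] MInf
        by (simp add: V_mean_def expectation_finite_support[OF fin])
    qed
    then have "mono (\<lambda>x. ereal (?E x))" by (auto intro: monoI)
    from Lim_at_bot_less[OF this, of "ereal (?E c)"] obtain a where a: "?E a < ?E c"
      using less MInf by (auto simp: expected_loss_def)
    moreover have "a < c" using mono[of c a] a by (cases "c \<le> a") auto
    ultimately show ?thesis using MInf by auto
  next
    case PInf
    then show ?thesis using c by simp
  qed
qed

section \<open>Bounds for isotonic optima\<close>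

lemma finite_support_weighted_empirical:
  assumes "i \<le> j" and w: "\<And>s. s \<in> {i..j} \<Longrightarrow> w s > 0"
  shows "finite (set_pmf (weighted_empirical w v i j))"
proof -
  let ?P = "weighted_empirical w v i j" and ?B = "v ` {i..j}"
  have "measure_pmf.prob ?P ?B = measure_pmf.expectation ?P (indicator ?B)" by simp
  also have "\<dots> = (\<Sum>s=i..j. w s * indicator ?B (v s)) / (\<Sum>s=i..j. w s)"
    by (rule expectation_weighted_empirical[OF assms])
  also have "(\<Sum>s=i..j. w s * indicator ?B (v s)) = (\<Sum>s=i..j. w s)"
    by (intro sum.cong) auto
  also have "(\<Sum>s=i..j. w s) / (\<Sum>s=i..j. w s) = 1"
    using sum_pos[of "{i..j}" w] assms by auto
  finally have "set_pmf ?P \<subseteq> ?B"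
    by (subst (asm) measure_pmf.prob_eq_1) (auto simp: AE_measure_pmf_iff)
  then show ?thesis by (rule finite_subset) simp
qed

text \<open>The right limit of \<open>V\<close> in its first argument. The loss over an interval \<open>{a<..b}\<close> sees \<open>V\<close> at
  \<open>b\<close> but only to the right of \<open>a\<close>. Lowering a block to \<open>a\<close> is therefore governed by the right limit
  of \<open>V\<close> at \<open>a\<close>, just as raising it to \<open>b\<close> is governed by the value at \<open>b\<close>.\<close>

definition V_right :: "(real \<Rightarrow> real \<Rightarrow> real) \<Rightarrow> real \<Rightarrow> real \<Rightarrow> real" where
  "V_right V x u = (INF \<eta>\<in>{x<..}. V \<eta> u)"

lemma V_right_bounds:
  assumes "identification_function V"
  shows "V x u \<le> V_right V x u" and "x < \<eta> \<Longrightarrow> V_right V x u \<le> V \<eta> u"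
proof -
  have le: "V a u \<le> V b u" if "a \<le> b" for a b
    using assms that by (auto simp: identification_function_def mono_def)
  show "V x u \<le> V_right V x u"
    unfolding V_right_def by (rule cINF_greatest) (auto intro: le)
  show "V_right V x u \<le> V \<eta> u" if "x < \<eta>"
    unfolding V_right_def using that
    by (intro cINF_lower) (auto intro!: bdd_belowI2[of _ "V x u"] le)
qed

lemma V_right_tendsto:
  assumes "identification_function V"
  shows "((\<lambda>\<eta>. V \<eta> u) \<longlongrightarrow> V_right V x u) (at_right x)"
  using Lim_right_bound[of UNIV x "\<lambda>\<eta>. V \<eta> u" "V x u"] assms
  by (auto simp: V_right_def identification_function_def mono_def)

text \<open>The abstract bounds apply with \<open>D s c = w s * V c (y s)\<close> for the lower and
  \<open>D s c = w s * V_right V c (y s)\<close> for the upper bound. Left-continuity of \<open>V\<close> gives the sign of the sum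
  at a point \<open>b \<le> T_minus\<close> from its sign to the left of \<open>b\<close>. The right limit does the same at a point
  above or equal to \<open>T_plus\<close>.\<close>

lemma optimal_sequence_bounds:
  fixes w y x :: "nat \<Rightarrow> real"
  assumes V: "identification_function V" and L: "L \<in> loss_class V"
    and consistent: "strictly_consistent L (T_functional V)"
    and w: "\<And>s. w s > 0"
    and x_mono: "mono_on {1..n} x"
    and x_opt: "\<And>x'. mono_on {1..n} x' \<Longrightarrow>
      (\<Sum>s=1..n. w s * L (x s) (y s)) \<le> (\<Sum>s=1..n. w s * L (x' s) (y s))"
    and l: "l \<in> {1..n}"
  shows "\<exists>j\<in>{l..n}. \<forall>i\<in>{1..j}. T_minus V (weighted_empirical w y i j) \<le> ereal (x l)"
      (is ?lower)
    and "\<exists>i\<in>{1..l}. \<forall>j\<in>{i..n}. ereal (x l) \<le> T_plus V (weighted_empirical w y i j)"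
      (is ?upper)
proof -
  let ?P = "weighted_empirical w y"
  have fin: "finite (set_pmf (?P i j))" if "i \<le> j" for i j
    using that w by (rule finite_support_weighted_empirical)
  have total: "(\<Sum>s=i..j. w s) > 0" if "i \<le> j" for i j
    using that w by (intro sum_pos) auto
  have E: "measure_pmf.expectation (?P i j) f = (\<Sum>s=i..j. w s * f (y s)) / (\<Sum>s=i..j. w s)"
    if "i \<le> j" for i j and f :: "real \<Rightarrow> real"
    using that w by (rule expectation_weighted_empirical)
  have V_neg: "(\<Sum>s=i..j. w s * V c (y s)) < 0" if "i \<le> j" "ereal c < T_minus V (?P i j)"
    for i j c
    using V_mean_neg_below_T_minus[OF V fin that(2)] that(1) total[of i j]
    by (auto simp: V_mean_def E divide_less_0_iff)
  have V_pos: "0 < (\<Sum>s=i..j. w s * V c (y s))" if "i \<le> j" "T_plus V (?P i j) < ereal c"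
    for i j c
    using V_mean_pos_above_T_plus[OF V fin that(2)] that(1) total[of i j]
    by (auto simp: V_mean_def E zero_less_divide_iff)
  have V_le: "V a u \<le> V b u" if "a \<le> b" for a b u
    using V that by (auto simp: identification_function_def mono_def)
  have sum_le: "(\<Sum>s\<in>A. w s * V a (y s)) \<le> (\<Sum>s\<in>A. w s * V b (y s))" if "a \<le> b" for A a b
    using w V_le[OF that] by (intro sum_mono mult_left_mono) (auto intro: less_imp_le)
  have right_le: "(\<Sum>s\<in>A. w s * V_right V a (y s)) \<le> (\<Sum>s\<in>A. w s * V b (y s))"
    if "a < b" for A a b
    using w V_right_bounds(2)[OF V that]
    by (intro sum_mono mult_left_mono) (auto intro: less_imp_le)
  have le_right: "(\<Sum>s\<in>A. w s * V a (y s)) \<le> (\<Sum>s\<in>A. w s * V_right V a (y s))" for A a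
    using w V_right_bounds(1)[OF V]
    by (intro sum_mono mult_left_mono) (auto intro: less_imp_le)
  show ?lower
  proof (rule isotonic_optimum_lower_bound[where D = "\<lambda>s c. w s * V c (y s)"
        and cost = "\<lambda>s c. w s * L c (y s)"])
    fix A a b c assume "a \<le> b" "b \<le> c" and le: "(\<Sum>s\<in>A. w s * V c (y s)) \<le> 0"
    then show "(\<Sum>s\<in>A. w s * L b (y s)) \<le> (\<Sum>s\<in>A. w s * L a (y s))"
      by (intro loss_sum_antimono[OF L] order.trans[OF sum_le le]) auto
  next
    fix A a b c t assume "a \<le> b" "b \<le> c" and less: "(\<Sum>s\<in>A. w s * V c (y s)) < 0"
      and "w t * L a (y t) \<noteq> w t * L b (y t)"
    then show "(\<Sum>s\<in>A. w s * L b (y s)) < (\<Sum>s\<in>A. w s * L a (y s))"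
      by (intro loss_sum_strict_antimono[OF L, where u = "y t"]
          order.strict_trans1[OF sum_le less]) auto
  next
    fix i j c assume ij: "i \<in> {1..j}" "j \<in> {1..n}" and c: "ereal c < T_minus V (?P i j)"
    show "(\<Sum>s=i..j. w s * V c (y s)) < 0" using V_neg c ij by auto
    obtain b where b: "c < b" "ereal b \<le> T_minus V (?P i j)"
      "measure_pmf.expectation (?P i j) (L b) < measure_pmf.expectation (?P i j) (L c)"
      using improvement_below_T_minus[OF V L consistent fin c] ij by auto
    have "(\<Sum>s=i..j. w s * V b (y s)) \<le> 0"
    proof (rule tendsto_upperbound)
      show "((\<lambda>\<eta>. \<Sum>s=i..j. w s * V \<eta> (y s)) \<longlongrightarrow> (\<Sum>s=i..j. w s * V b (y s))) (at_left b)"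
        using V by (intro tendsto_intros)
          (auto simp: identification_function_def continuous_within)
      show "eventually (\<lambda>\<eta>. (\<Sum>s=i..j. w s * V \<eta> (y s)) \<le> 0) (at_left b)"
      proof (rule eventually_at_leftI[of "b - 1"])
        fix \<eta> assume "\<eta> \<in> {b - 1<..<b}"
        then have "ereal \<eta> < T_minus V (?P i j)"
          using order.strict_trans2[OF _ b(2), of "ereal \<eta>"] by simp
        then show "(\<Sum>s=i..j. w s * V \<eta> (y s)) \<le> 0" using V_neg[of i j \<eta>] ij by auto
      qed simp
    qed simp
    moreover have "(\<Sum>s=i..j. w s * L b (y s)) < (\<Sum>s=i..j. w s * L c (y s))"
      using b(3) ij total[of i j] by (simp add: E divide_less_cancel)
    ultimately show "\<exists>b>c. ereal b \<le> T_minus V (?P i j) \<and> (\<Sum>s=i..j. w s * V b (y s)) \<le> 0 \<and>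
        (\<Sum>s=i..j. w s * L b (y s)) < (\<Sum>s=i..j. w s * L c (y s))"
      using b by blast
  qed (use x_mono x_opt l in auto)
  show ?upper
  proof (rule isotonic_optimum_upper_bound[where D = "\<lambda>s c. w s * V_right V c (y s)"
        and cost = "\<lambda>s c. w s * L c (y s)"])
    fix A a b c assume "c \<le> a" "a \<le> b" and le: "0 \<le> (\<Sum>s\<in>A. w s * V_right V c (y s))"
    then show "(\<Sum>s\<in>A. w s * L a (y s)) \<le> (\<Sum>s\<in>A. w s * L b (y s))"
      by (intro loss_sum_mono[OF L] order.trans[OF le right_le]) auto
  next
    fix A a b c t assume "c \<le> a" "a \<le> b" and less: "0 < (\<Sum>s\<in>A. w s * V_right V c (y s))"
      and "w t * L a (y t) \<noteq> w t * L b (y t)"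
    then show "(\<Sum>s\<in>A. w s * L a (y s)) < (\<Sum>s\<in>A. w s * L b (y s))"
      by (intro loss_sum_strict_mono[OF L, where u = "y t"]
          order.strict_trans2[OF less right_le]) auto
  next
    fix i j c assume ij: "i \<in> {1..n}" "j \<in> {i..n}" and c: "T_plus V (?P i j) < ereal c"
    show "0 < (\<Sum>s=i..j. w s * V_right V c (y s))"
      using order.strict_trans2[OF V_pos[OF _ c] le_right] ij by auto
    obtain a where a: "a < c" "T_plus V (?P i j) \<le> ereal a"
      "measure_pmf.expectation (?P i j) (L a) < measure_pmf.expectation (?P i j) (L c)"
      using improvement_above_T_plus[OF V L consistent fin c] ij by auto
    have "0 \<le> (\<Sum>s=i..j. w s * V_right V a (y s))"
    proof (rule tendsto_lowerbound)
      show "((\<lambda>\<eta>. \<Sum>s=i..j. w s * V \<eta> (y s)) \<longlongrightarrow> (\<Sum>s=i..j. w s * V_right V a (y s)))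
          (at_right a)"
        by (intro tendsto_intros V_right_tendsto[OF V])
      show "eventually (\<lambda>\<eta>. 0 \<le> (\<Sum>s=i..j. w s * V \<eta> (y s))) (at_right a)"
      proof (rule eventually_at_rightI[of _ "a + 1"])
        fix \<eta> assume "\<eta> \<in> {a<..<a + 1}"
        then have "T_plus V (?P i j) < ereal \<eta>"
          using order.strict_trans1[OF a(2), of "ereal \<eta>"] by simp
        then show "0 \<le> (\<Sum>s=i..j. w s * V \<eta> (y s))" using V_pos[of i j \<eta>] ij by auto
      qed simp
    qed simp
    moreover have "(\<Sum>s=i..j. w s * L a (y s)) < (\<Sum>s=i..j. w s * L c (y s))"
      using a(3) ij total[of i j] by (simp add: E divide_less_cancel)
    ultimately show "\<exists>a<c. T_plus V (?P i j) \<le> ereal a \<and>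
        0 \<le> (\<Sum>s=i..j. w s * V_right V a (y s)) \<and>
        (\<Sum>s=i..j. w s * L a (y s)) < (\<Sum>s=i..j. w s * L c (y s))"
      using a by blast
  qed (use x_mono x_opt l in auto)
qed

lemma mean_empirical:
  assumes "i \<le> j"
  shows "pmf_mean (empirical v i j) = sum v {i..j} / real (Suc j - i)"
  unfolding pmf_mean_def empirical_def integral_map_pmf
  using assms by (subst integral_pmf_of_set) auto

section \<open>Optimal functions of the covariate\<close>

text \<open>Every antitonic competitor exceeds the fit at least by the sum of its pointwise score
  excesses, which are nonnegative, and positive off the fitted values if \<open>h\<close> is strictly
  decreasing.\<close>

lemma fit_optimal_antitonic:
  fixes z :: "nat \<Rightarrow> 'z::linorder" and g1 :: "'z \<Rightarrow> real"
  assumes z: "strict_mono_on {1..n} z" and h: "antimono h"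
    and fit: "isotonic_fit 1 n (\<lambda>s. - L (g1 (z s)) (y s)) x"
  shows "\<forall>l\<in>{1..n}. g2 (z l) = - x l \<Longrightarrow> optimal_antitonic n z y h L g1 g2"
    and "\<lbrakk>strict_antimono_on UNIV h; optimal_antitonic n z y h L g1 g2; l \<in> {1..n}\<rbrakk>
      \<Longrightarrow> g2 (z l) = - x l"
proof -
  define a where "a s = L (g1 (z s)) (y s)" for s
  note fit_a = fit[folded a_def]
  have crit: "criterion n z y h L g1 g =
      (\<Sum>s=1..n. int_h h (g (z s)) + h (g (z s)) * (a s - g (z s)))" for g
    by (simp add: criterion_def a_def)
  have z_le: "z r \<le> z s \<longleftrightarrow> r \<le> s" if "r \<in> {1..n}" "s \<in> {1..n}" for r s
    using strict_mono_on_less_eq[OF z that] .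
  have along_z: "antimono_on {1..n} (\<lambda>s. g (z s))" if "antimono_on (z ` {1..n}) g" for g :: "'z \<Rightarrow> real"
    using that z_le by (auto simp: monotone_on_def)
  let ?excess = "\<lambda>g s. int_h h (g (z s)) + h (g (z s)) * (- x s - g (z s)) - int_h h (- x s)"
  have excess: "0 \<le> ?excess g s" for g s
    using int_h_supergradient[OF h, of "- x s" "g (z s)"] by simp
  have gap: "criterion n z y h L g1 g' + (\<Sum>s=1..n. ?excess g s) \<le> criterion n z y h L g1 g"
    if "antimono_on (z ` {1..n}) g" "\<forall>l\<in>{1..n}. g' (z l) = - x l"
    for g g' :: "'z \<Rightarrow> real"
  proof -
    have "criterion n z y h L g1 g' = (\<Sum>s=1..n. int_h h (- x s) + h (- x s) * (a s + x s))"
      unfolding crit using that(2) by (intro sum.cong) auto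
    then show ?thesis using criterion_gap[OF h fit_a along_z[OF that(1)]] by (simp add: crit)
  qed
  have optimal: "optimal_antitonic n z y h L g1 g'"
    if g': "\<forall>l\<in>{1..n}. g' (z l) = - x l" for g'
    unfolding optimal_antitonic_def
  proof (intro conjI allI impI)
    have "mono_on {1..n} x" using fit by (simp add: isotonic_fit_def)
    then show "antimono_on (z ` {1..n}) g'" using g' z_le by (auto simp: monotone_on_def)
    fix g :: "'z \<Rightarrow> real" assume "antimono_on (z ` {1..n}) g"
    from gap[OF this g'] show "criterion n z y h L g1 g' \<le> criterion n z y h L g1 g"
      using sum_nonneg[of "{1..n}" "?excess g"] excess by simp
  qed
  then show "\<forall>l\<in>{1..n}. g2 (z l) = - x l \<Longrightarrow> optimal_antitonic n z y h L g1 g2" .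
  assume strict: "strict_antimono_on UNIV h" and g2: "optimal_antitonic n z y h L g1 g2"
    and l: "l \<in> {1..n}"
  \<comment> \<open>A function of the covariate with the fitted values, to compare \<open>g2\<close> with.\<close>
  define g' where "g' t = - x (the_inv_into {1..n} z t)" for t
  have g': "\<forall>l\<in>{1..n}. g' (z l) = - x l"
    using the_inv_into_f_f[OF strict_mono_on_imp_inj_on[OF z]] by (simp add: g'_def)
  have "antimono_on (z ` {1..n}) g2" "criterion n z y h L g1 g2 \<le> criterion n z y h L g1 g'"
    using g2 optimal[OF g'] by (auto simp: optimal_antitonic_def)
  with gap[OF this(1) g'] have "(\<Sum>s=1..n. ?excess g2 s) \<le> 0" by linarith
  then have "(\<Sum>s=1..n. ?excess g2 s) = 0"
    using sum_nonneg[of "{1..n}" "?excess g2"] excess by (intro antisym) auto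
  then have "?excess g2 l = 0"
    using sum_nonneg_eq_0_iff[of "{1..n}" "?excess g2"] excess l by blast
  then show "g2 (z l) = - x l"
    using int_h_supergradient_strict[OF strict, of "- x l" "g2 (z l)"]
    by (cases "g2 (z l) = - x l") auto
qed

text \<open>With \<open>g2\<close> fixed, the criterion is a constant plus a weighted sum of losses, and isotonic functions of
  the covariate correspond to isotonic sequences.\<close>

lemma optimal_isotonic_sequence:
  fixes z :: "nat \<Rightarrow> 'z::linorder" and g1 g2 :: "'z \<Rightarrow> real"
  assumes z: "strict_mono_on {1..n} z" and opt: "optimal_isotonic n z y h L g2 g1"
  shows "mono_on {1..n} (\<lambda>s. g1 (z s))"
    and "mono_on {1..n} x' \<Longrightarrow>
      (\<Sum>s=1..n. h (g2 (z s)) * L (g1 (z s)) (y s)) \<le> (\<Sum>s=1..n. h (g2 (z s)) * L (x' s) (y s))"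
proof -
  have z_le: "z r \<le> z s \<longleftrightarrow> r \<le> s" if "r \<in> {1..n}" "s \<in> {1..n}" for r s
    using strict_mono_on_less_eq[OF z that] .
  show "mono_on {1..n} (\<lambda>s. g1 (z s))"
    using opt z_le by (auto simp: optimal_isotonic_def monotone_on_def)
  assume x': "mono_on {1..n} x'"
  define g where "g t = x' (the_inv_into {1..n} z t)" for t
  have g: "g (z s) = x' s" if "s \<in> {1..n}" for s
    using that the_inv_into_f_f[OF strict_mono_on_imp_inj_on[OF z]] by (simp add: g_def)
  have "mono_on (z ` {1..n}) g" using x' g z_le by (auto simp: monotone_on_def)
  then have "criterion n z y h L g1 g2 \<le> criterion n z y h L g g2"
    using opt by (auto simp: optimal_isotonic_def)
  also have "\<dots> = (\<Sum>s=1..n. int_h h (g2 (z s)) + h (g2 (z s)) * (L (x' s) (y s) - g2 (z s)))"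
    unfolding criterion_def using g by (intro sum.cong) auto
  finally show "(\<Sum>s=1..n. h (g2 (z s)) * L (g1 (z s)) (y s))
      \<le> (\<Sum>s=1..n. h (g2 (z s)) * L (x' s) (y s))"
    by (simp add: criterion_def sum.distrib sum_subtractf right_diff_distrib)
qed

theorem proposition3p1:
  fixes V L :: "real \<Rightarrow> real \<Rightarrow> real"
    and n :: nat and z :: "nat \<Rightarrow> 'z::linorder" and y :: "nat \<Rightarrow> real"
    and h :: "real \<Rightarrow> real"
  assumes V: "identification_function V"
    and L_class: "L \<in> loss_class V"
    and L_consistent: "strictly_consistent L (T_functional V)"
    and z: "strict_mono_on {1..n} z"
    and h_pos: "\<And>x. h x > 0"
    and h_antimono: "antimono h"
    and h_lim: "(h \<longlongrightarrow> 0) at_top"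
  shows
    "(\<forall>g1 :: 'z \<Rightarrow> real.
        let E = (\<lambda>i j. pmf_mean (empirical (\<lambda>s. L (g1 (z s)) (y s)) i j)) in
        (\<forall>l\<in>{1..n}.
           - (MIN j\<in>{l..n}. MAX i\<in>{1..j}. - E i j) = - (MAX i\<in>{1..l}. MIN j\<in>{i..n}. - E i j)) \<and>
        (\<forall>g2 :: 'z \<Rightarrow> real.
           (\<forall>l\<in>{1..n}. g2 (z l) = - (MIN j\<in>{l..n}. MAX i\<in>{1..j}. - E i j)) \<longrightarrow>
           optimal_antitonic n z y h L g1 g2) \<and>
        (strict_antimono_on UNIV h \<longrightarrow>
          (\<forall>g2 :: 'z \<Rightarrow> real. optimal_antitonic n z y h L g1 g2 \<longrightarrow>
             (\<forall>l\<in>{1..n}. g2 (z l) = - (MIN j\<in>{l..n}. MAX i\<in>{1..j}. - E i j)))))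
   \<and> (\<forall>g2 g1 :: 'z \<Rightarrow> real.
        optimal_isotonic n z y h L g2 g1 \<longrightarrow>
        (let P = weighted_empirical (\<lambda>s. h (g2 (z s))) y in
         \<forall>l\<in>{1..n}.
           (MIN j\<in>{l..n}. MAX i\<in>{1..j}. T_minus V (P i j)) \<le> ereal (g1 (z l)) \<and>
           ereal (g1 (z l)) \<le> (MAX i\<in>{1..l}. MIN j\<in>{i..n}. T_plus V (P i j))))"
proof (intro conjI allI impI)
  fix g1 :: "'z \<Rightarrow> real"
  define E where "E i j = pmf_mean (empirical (\<lambda>s. L (g1 (z s)) (y s)) i j)" for i j
  define b where "b s = - L (g1 (z s)) (y s)" for s
  have E: "- E i j = sum b {i..j} / real (Suc j - i)" if "i \<le> j" for i j
    using mean_empirical[OF that] by (simp add: E_def b_def sum_negf)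
  obtain x where fit: "isotonic_fit 1 n b x" using isotonic_fit_exists by blast
  have minimax: "(MIN j\<in>{l..n}. MAX i\<in>{1..j}. - E i j) = x l"
    and maximin: "(MAX i\<in>{1..l}. MIN j\<in>{i..n}. - E i j) = x l" if l: "l \<in> {1..n}" for l
  proof -
    obtain j where j: "j \<in> {l..n}" "\<And>i. i \<in> {1..j} \<Longrightarrow> - E i j \<le> x l"
      using isotonic_fit_saddle_point(1)[OF fit l] by (auto simp: E)
    obtain i where i: "i \<in> {1..l}" "\<And>j. j \<in> {i..n} \<Longrightarrow> x l \<le> - E i j"
      using isotonic_fit_saddle_point(2)[OF fit l] by (auto simp: E)
    show "(MIN j\<in>{l..n}. MAX i\<in>{1..j}. - E i j) = x l"
      using minimax_le[where M = "\<lambda>i j. - E i j", OF l j]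
        le_minimax[where M = "\<lambda>i j. - E i j", OF l i] by (rule antisym)
    show "(MAX i\<in>{1..l}. MIN j\<in>{i..n}. - E i j) = x l"
      using maximin_le[where M = "\<lambda>i j. - E i j", OF l j]
        le_maximin[where M = "\<lambda>i j. - E i j", OF l i] by (rule antisym)
  qed
  note fit_optimal = fit_optimal_antitonic[where L = L and y = y and ?g1.0 = g1, OF z h_antimono fit[unfolded b_def[abs_def]]]
  show "let E = (\<lambda>i j. pmf_mean (empirical (\<lambda>s. L (g1 (z s)) (y s)) i j)) in
        (\<forall>l\<in>{1..n}.
           - (MIN j\<in>{l..n}. MAX i\<in>{1..j}. - E i j) = - (MAX i\<in>{1..l}. MIN j\<in>{i..n}. - E i j)) \<and>
        (\<forall>g2 :: 'z \<Rightarrow> real.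
           (\<forall>l\<in>{1..n}. g2 (z l) = - (MIN j\<in>{l..n}. MAX i\<in>{1..j}. - E i j)) \<longrightarrow>
           optimal_antitonic n z y h L g1 g2) \<and>
        (strict_antimono_on UNIV h \<longrightarrow>
          (\<forall>g2 :: 'z \<Rightarrow> real. optimal_antitonic n z y h L g1 g2 \<longrightarrow>
             (\<forall>l\<in>{1..n}. g2 (z l) = - (MIN j\<in>{l..n}. MAX i\<in>{1..j}. - E i j))))"
    unfolding Let_def E_def[symmetric]
  proof (intro conjI allI impI ballI)
    fix l assume "l \<in> {1..n}"
    then show "- (MIN j\<in>{l..n}. MAX i\<in>{1..j}. - E i j) = - (MAX i\<in>{1..l}. MIN j\<in>{i..n}. - E i j)"
      by (simp only: minimax maximin)
  next
    fix g2 assume g2: "\<forall>l\<in>{1..n}. g2 (z l) = - (MIN j\<in>{l..n}. MAX i\<in>{1..j}. - E i j)"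
    show "optimal_antitonic n z y h L g1 g2"
    proof (rule fit_optimal(1), rule ballI)
      fix l assume l: "l \<in> {1..n}"
      show "g2 (z l) = - x l" using g2[rule_format, OF l] unfolding minimax[OF l] .
    qed
  next
    fix g2 l assume "strict_antimono_on UNIV h" "optimal_antitonic n z y h L g1 g2" "l \<in> {1..n}"
    then show "g2 (z l) = - (MIN j\<in>{l..n}. MAX i\<in>{1..j}. - E i j)"
      unfolding minimax[OF \<open>l \<in> {1..n}\<close>] by (rule fit_optimal(2))
  qed
next
  fix g2 g1 :: "'z \<Rightarrow> real"
  assume opt: "optimal_isotonic n z y h L g2 g1"
  show "let P = weighted_empirical (\<lambda>s. h (g2 (z s))) y in
         \<forall>l\<in>{1..n}.
           (MIN j\<in>{l..n}. MAX i\<in>{1..j}. T_minus V (P i j)) \<le> ereal (g1 (z l)) \<and>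
           ereal (g1 (z l)) \<le> (MAX i\<in>{1..l}. MIN j\<in>{i..n}. T_plus V (P i j))"
    unfolding Let_def
  proof (intro ballI conjI)
    fix l assume l: "l \<in> {1..n}"
    let ?P = "weighted_empirical (\<lambda>s. h (g2 (z s))) y"
    note bounds = optimal_sequence_bounds[where w = "\<lambda>s. h (g2 (z s))", OF V L_class L_consistent h_pos
        optimal_isotonic_sequence[OF z opt] l]
    obtain j where j: "j \<in> {l..n}" "\<And>i. i \<in> {1..j} \<Longrightarrow> T_minus V (?P i j) \<le> ereal (g1 (z l))"
      using bounds(1) by blast
    show "(MIN j\<in>{l..n}. MAX i\<in>{1..j}. T_minus V (?P i j)) \<le> ereal (g1 (z l))"
      using minimax_le[where M = "\<lambda>i j. T_minus V (?P i j)", OF l j] .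
    obtain i where i: "i \<in> {1..l}" "\<And>j. j \<in> {i..n} \<Longrightarrow> ereal (g1 (z l)) \<le> T_plus V (?P i j)"
      using bounds(2) by blast
    show "ereal (g1 (z l)) \<le> (MAX i\<in>{1..l}. MIN j\<in>{i..n}. T_plus V (?P i j))"
      using le_maximin[where M = "\<lambda>i j. T_plus V (?P i j)", OF l i] .
  qed
qed

end
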